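(* Let $f$ be $C^6$ with $\|\nabla^if(\mathbf{y})\|_2\le M$ for all $\mathbf{y}\in\mathbb{R}^d$, $i=2,\dots,6$, where $0<M<\infty$, let $\mathbf{x}^*$ be an index-$k$ saddle point satisfying the eigenvalue assumption given in the context, let $l(n)\equiv l>0$ be constant, and let the eigenvector-accuracy assumption given in the context hold with parameter $\theta$. Let the outer step size be a constant $\alpha(n)\equiv\alpha>0$, sufficiently small such that $$0<\alpha<\frac{(1-\sqrt\theta)\mu-M\theta-5M\sqrt\theta}{(2d+4)M^2+1}.$$ Let $U=\big\{\mathbf{x}:\|\mathbf{x}-\mathbf{x}^*\|_2\le\min\big(\tfrac{(1-\sqrt\theta)\mu}{M}-\theta-5\sqrt\theta,\ \delta\big)\big\}$ and $E^\infty=\{\mathbf{x}(n)\in U\ \forall n\}$. Then, provided that the boundedness event $E^\infty$ occurs with positive probability, the iterates $\mathbf{x}(n)$ generated by the derivative-free saddle-search algorithm approach a neighborhood of $\mathbf{x}^*$ with radius $O(l^2/\sqrt\alpha)$, at a linear decay rate determined by a constant $0<\sigma<1$, i.e. $$\mathbb{E}\big[\|\mathbf{x}(n)-\mathbf{x}^*\|_2^2\,\big|\,E^\infty\big]\le O\big(\sigma^n+l^4/\alpha\big).$$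
   Context: Let $d\ge2$, $1\le k\le d-1$, $f:\mathbb{R}^d\to\mathbb{R}$; norms of derivative tensors are operator norms. Eigenvalue assumption: $\nabla f(\mathbf{x}^* )=0$, and there are $\delta>0$, $\mu\in(0,M)$ such that for all $\mathbf{x}$ with $\|\mathbf{x}-\mathbf{x}^*\|_2\le\delta$ the eigenvalues of $\nabla^2f(\mathbf{x})$ satisfy $-M\le\lambda_1\le\dots\le\lambda_k<-\mu<0<\mu<\lambda_{k+1}\le\dots\le\lambda_d\le M$. Definitions: $f_l(\mathbf{x})=\mathbb{E}_{\mathbf{r}\sim\mathcal N(0,I)}[f(\mathbf{x}+l\mathbf{r})]$, $F(\mathbf{x},\mathbf{r},l)=\frac{f(\mathbf{x}+l\mathbf{r})-f(\mathbf{x}-l\mathbf{r})}{2l}\mathbf{r}$, $H_{\mathbf{v}}(\mathbf{x},\mathbf{r},l)=\frac{F(\mathbf{x}+l\mathbf{v},\mathbf{r},l)-F(\mathbf{x}-l\mathbf{v},\mathbf{r},l)}{2l}$. Derivative-free saddle-search algorithm: from $\mathbf{x}(0)$, for $n\ge0$, draw $\mathbf{r}(n)\sim\mathcal N(0,I)$ independent of the past and set $$\mathbf{x}(n+1)=\mathbf{x}(n)-\alpha\big(I-2\tilde V(n)\tilde V(n)^\top\big)F(\mathbf{x}(n),\mathbf{r}(n),l),$$ where $\tilde V(n)=[\tilde{\mathbf{v}}_1,\dots,\tilde{\mathbf{v}}_k]$ has orthonormal columns and is the output (independent of $\mathbf{r}(n)$) of an inner eigenvector search at $\mathbf{x}=\mathbf{x}(n)$.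 The inner search computes, successively for $j=1,\dots,k$, a unit vector $\tilde{\mathbf{v}}_j$ orthogonal to the previous ones by finitely many steps $\mathbf{v}_j\leftarrow\mathbf{v}_j-\alpha_{\mathbf{v}}(i)(I-\mathbf{v}_j\mathbf{v}_j^\top-\sum_{q<j}\tilde{\mathbf{v}}_q\tilde{\mathbf{v}}_q^\top)H_{\mathbf{v}_j}(\mathbf{x},\mathbf{r},\cdot)$, each followed by normalization $\mathbf{v}_j\leftarrow\mathbf{v}_j/\|\mathbf{v}_j\|_2$, with fresh Gaussian samples $\mathbf{r}\sim\mathcal N(0,I)$, where $\alpha_{\mathbf{v}}(i)$ are inner step sizes and the last argument of $H_{\mathbf{v}_j}$ is the difference length; the accuracy of $\tilde V(n)$ is given by the following assumption. Eigenvector-accuracy assumption: there is a small parameter $\theta$ such that, with $\mu_l=\mu-Ml^2d/2$, $$\theta>\frac{\sqrt{2k}Ml^2d}{4\mu}>0,\qquad (1-\sqrt\theta)\mu_{l}-M\theta-5M\sqrt\theta>0,$$ and, for every outer iteration $n$, almost surely $$\min\big(\|\tilde V(n)\tilde V(n)^\top-V(n)V(n)^\top\|_2^2,\ \|\tilde V(n)\tilde V(n)^\top-V_{l}(n)V_{l}(n)^\top\|_2^2\big)\le\theta,$$ where $V(n)V(n)^\top$ and $V_l(n)V_l(n)^\top$ are the orthogonal projections onto the span of eigenvectors for the $k$ smallest eigenvalues of $\nabla^2f(\mathbf{x}(n))$ and $\nabla^2f_{l}(\mathbf{x}(n))$ respectively. *)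

theory Defs
  imports "HOL-Probability.Probability"
begin

text \<open>Iterated Frechet derivatives: \<open>dderiv f [u\<^sub>1, \<dots>, u\<^sub>m] x\<close> is the value at
  \<open>(u\<^sub>1, \<dots>, u\<^sub>m)\<close> of the \<open>m\<close>-linear form given by the \<open>m\<close>-th derivative of \<open>f\<close> at \<open>x\<close>.\<close>

fun dderiv :: "('a::euclidean_space \<Rightarrow> real) \<Rightarrow> 'a list \<Rightarrow> 'a \<Rightarrow> real" where
  "dderiv f [] x = f x"
| "dderiv f (u # us) x = frechet_derivative (dderiv f us) (at x) u"

definition C_k :: "nat \<Rightarrow> ('a::euclidean_space \<Rightarrow> real) \<Rightarrow> bool" where
  "C_k m f \<longleftrightarrow>
     (\<forall>us x. length us < m \<longrightarrow> dderiv f us differentiable (at x)) \<and>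
     (\<forall>us. length us \<le> m \<longrightarrow> continuous_on UNIV (dderiv f us))"

text \<open>Operator norm of the derivative tensor; extended-real valued so that the supremum is
  meaningful without a separate boundedness proof.\<close>

definition deriv_norm :: "nat \<Rightarrow> ('a::euclidean_space \<Rightarrow> real) \<Rightarrow> 'a \<Rightarrow> ereal" where
  "deriv_norm m f x =
     (SUP us \<in> {us. length us = m \<and> (\<forall>u\<in>set us. norm u \<le> 1)}. ereal \<bar>dderiv f us x\<bar>)"

definition grad :: "(real^'n \<Rightarrow> real) \<Rightarrow> real^'n \<Rightarrow> real^'n" where
  "grad f x = (\<chi> i. dderiv f [axis i 1] x)"

definition hess :: "(real^'n \<Rightarrow> real) \<Rightarrow> real^'n \<Rightarrow> real^'n^'n" where
  "hess f x = (\<chi> i j. dderiv f [axis i 1, axis j 1] x)"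

text \<open>\<open>lam 1 \<le> \<dots> \<le> lam d\<close> are the eigenvalues of \<open>A\<close>, i.e. the roots of its characteristic
  polynomial with multiplicity; values of \<open>lam\<close> outside \<open>{1..d}\<close> are irrelevant.\<close>

definition sorted_eigenvalues :: "real^'n^'n \<Rightarrow> (nat \<Rightarrow> real) \<Rightarrow> bool" where
  "sorted_eigenvalues A lam \<longleftrightarrow>
     mono_on {1..CARD('n)} lam \<and>
     (\<forall>t. det (mat t - A) = (\<Prod>i = 1..CARD('n). t - lam i))"

text \<open>The matrix \<open>V V\<^sup>T\<close> for \<open>V\<close> with columns \<open>v 1, \<dots>, v k\<close>.\<close>

definition gram_outer :: "nat \<Rightarrow> (nat \<Rightarrow> real^'n) \<Rightarrow> real^'n^'n" where
  "gram_outer k v = (\<chi> a b. \<Sum>j = 1..k. v j $ a * v j $ b)"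

text \<open>\<open>Q\<close> is the orthogonal projection onto the span of (orthonormal) eigenvectors of the symmetric
  matrix \<open>A\<close> for its \<open>k\<close> smallest eigenvalues.  It is unique when the \<open>k\<close>-th and \<open>(k+1)\<close>-st
  eigenvalues differ; otherwise any choice of the eigenvectors is admitted.\<close>

definition lowest_eigenprojection :: "nat \<Rightarrow> real^'n^'n \<Rightarrow> real^'n^'n \<Rightarrow> bool" where
  "lowest_eigenprojection k A Q \<longleftrightarrow>
     (\<exists>lam u. sorted_eigenvalues A lam \<and>
        (\<forall>i\<in>{1..CARD('n)}. A *v u i = lam i *\<^sub>R u i) \<and>
        (\<forall>i\<in>{1..CARD('n)}. \<forall>j\<in>{1..CARD('n)}. u i \<bullet> u j = (if i = j then 1 else 0)) \<and>
        Q = gram_outer k u)"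

definition eigenvalue_assumption ::
  "(real^'n \<Rightarrow> real) \<Rightarrow> nat \<Rightarrow> real^'n \<Rightarrow> real \<Rightarrow> real \<Rightarrow> real \<Rightarrow> bool" where
  "eigenvalue_assumption f k xs M \<mu> \<delta> \<longleftrightarrow>
     grad f xs = 0 \<and> 0 < \<delta> \<and> 0 < \<mu> \<and> \<mu> < M \<and>
     (\<forall>x. norm (x - xs) \<le> \<delta> \<longrightarrow>
        (\<exists>lam. sorted_eigenvalues (hess f x) lam \<and>
           - M \<le> lam 1 \<and> lam k < - \<mu> \<and> \<mu> < lam (k + 1) \<and> lam CARD('n) \<le> M))"

text \<open>The standard Gaussian law \<open>N(0, I)\<close>.\<close>

definition std_gaussian :: "(real^'n) measure" where
  "std_gaussian = density lborel (\<lambda>x. ennreal (\<Prod>i\<in>UNIV. std_normal_density (x $ i)))"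

definition smoothed :: "(real^'n \<Rightarrow> real) \<Rightarrow> real \<Rightarrow> real^'n \<Rightarrow> real" where
  "smoothed f l x = (\<integral>r. f (x + l *\<^sub>R r) \<partial>std_gaussian)"

definition F_est :: "(real^'n \<Rightarrow> real) \<Rightarrow> real^'n \<Rightarrow> real^'n \<Rightarrow> real \<Rightarrow> real^'n" where
  "F_est f x r l = ((f (x + l *\<^sub>R r) - f (x - l *\<^sub>R r)) / (2 * l)) *\<^sub>R r"

definition H_est :: "(real^'n \<Rightarrow> real) \<Rightarrow> real^'n \<Rightarrow> real^'n \<Rightarrow> real^'n \<Rightarrow> real \<Rightarrow> real^'n" where
  "H_est f v x r l = (1 / (2 * l)) *\<^sub>R (F_est f (x + l *\<^sub>R v) r l - F_est f (x - l *\<^sub>R v) r l)"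

text \<open>One step of the search for the \<open>j\<close>-th eigenvector, with step size \<open>a\<close>, difference length \<open>h\<close>
  and previously computed vectors \<open>w q\<close>, \<open>q < j\<close>.\<close>

definition inner_step ::
  "(real^'n \<Rightarrow> real) \<Rightarrow> nat \<Rightarrow> (nat \<Rightarrow> real^'n) \<Rightarrow> real^'n \<Rightarrow> real \<Rightarrow> real \<Rightarrow> real^'n \<Rightarrow> real^'n \<Rightarrow> real^'n"
  where
  "inner_step f j w x a h r v =
     (let z = v - a *\<^sub>R ((mat 1 - gram_outer 1 (\<lambda>_. v) - gram_outer (j - 1) w) *v H_est f v x r h)
      in z /\<^sub>R norm z)"

text \<open>
  A run of the derivative-free saddle search.
    \<^item> \<open>X n\<close>: outer iterates; \<open>r n\<close>: outer Gaussian samples; \<open>l\<close>, \<open>\<alpha>\<close>: outer difference length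
      and step size.
    \<^item> \<open>v n j i\<close>: \<open>i\<close>-th inner iterate for the \<open>j\<close>-th eigenvector (\<open>1 \<le> j \<le> k\<close>) at \<open>X n\<close>;
      \<open>s n j i\<close>: the sample used in passing from \<open>v n j i\<close> to \<open>v n j (i+1)\<close>;
      \<open>\<alpha>v i\<close>, \<open>lv n i\<close>: inner step sizes and difference lengths.
    \<^item> \<open>N n j\<close>: number of inner steps actually taken, so that the output is
      \<open>v n j (N n j)\<close>; it may be an adaptive stopping rule (continuing the recursion beyond
      \<open>N n j\<close> only fixes values that are never used).
    \<^item> \<open>\<F> n j i\<close> and \<open>\<G> n\<close>: the information available immediately before \<open>s n j i\<close>,
      respectively \<open>r n\<close>, is drawn.  Fresh samples are independent of it.

  The inner iterations are started at arbitrary unit vectors orthogonal to the previous outputs,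
  chosen from the available information; both properties are preserved by \<^const>\<open>inner_step\<close>,
  so the output vectors are orthonormal.
\<close>

locale saddle_search_run = prob_space P for P :: "'w measure" +
  fixes f :: "real^'n \<Rightarrow> real" and k :: nat and l \<alpha> :: real
    and \<alpha>v :: "nat \<Rightarrow> real" and lv :: "nat \<Rightarrow> nat \<Rightarrow> real"
    and X :: "nat \<Rightarrow> 'w \<Rightarrow> real^'n" and r :: "nat \<Rightarrow> 'w \<Rightarrow> real^'n"
    and v :: "nat \<Rightarrow> nat \<Rightarrow> nat \<Rightarrow> 'w \<Rightarrow> real^'n" and s :: "nat \<Rightarrow> nat \<Rightarrow> nat \<Rightarrow> 'w \<Rightarrow> real^'n"
    and N :: "nat \<Rightarrow> nat \<Rightarrow> 'w \<Rightarrow> nat"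
    and \<F> :: "nat \<Rightarrow> nat \<Rightarrow> nat \<Rightarrow> 'w measure" and \<G> :: "nat \<Rightarrow> 'w measure"
  assumes l_pos: "0 < l" and \<alpha>_pos: "0 < \<alpha>"
    and \<alpha>v_pos: "\<And>i. 0 < \<alpha>v i" and lv_pos: "\<And>n i. 0 < lv n i"
    and sub_\<F>: "\<And>n j i. j \<in> {1..k} \<Longrightarrow> subalgebra P (\<F> n j i)"
    and sub_\<G>: "\<And>n. subalgebra P (\<G> n)"
    and \<F>_step: "\<And>n j i. j \<in> {1..k} \<Longrightarrow> sets (\<F> n j i) \<subseteq> sets (\<F> n j (Suc i))"
    and \<F>_next: "\<And>n j i. j \<in> {1..<k} \<Longrightarrow> sets (\<F> n j i) \<subseteq> sets (\<F> n (Suc j) 0)"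
    and \<F>_\<G>: "\<And>n i. sets (\<F> n k i) \<subseteq> sets (\<G> n)"
    and \<G>_\<F>: "\<And>n. sets (\<G> n) \<subseteq> sets (\<F> (Suc n) 1 0)"
    and X0_meas: "X 0 \<in> measurable (\<F> 0 1 0) borel"
    and start_meas: "\<And>n j. j \<in> {1..k} \<Longrightarrow> v n j 0 \<in> measurable (\<F> n j 0) borel"
    and N_stopping: "\<And>n j. j \<in> {1..k} \<Longrightarrow> stopping_time (\<F> n j) (N n j)"
    and s_meas: "\<And>n j i. j \<in> {1..k} \<Longrightarrow> s n j i \<in> measurable (\<F> n j (Suc i)) borel"
    and s_gaussian: "\<And>n j i. j \<in> {1..k} \<Longrightarrow> distr P borel (s n j i) = std_gaussian"
    and s_fresh: "\<And>n j i. j \<in> {1..k} \<Longrightarrow>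
       indep_set (sets (\<F> n j i)) (sets (vimage_algebra (space P) (s n j i) borel))"
    and r_meas: "\<And>n. r n \<in> measurable (\<F> (Suc n) 1 0) borel"
    and r_gaussian: "\<And>n. distr P borel (r n) = std_gaussian"
    and r_fresh: "\<And>n. indep_set (sets (\<G> n)) (sets (vimage_algebra (space P) (r n) borel))"
    and start_unit: "\<And>n j \<omega>. j \<in> {1..k} \<Longrightarrow> \<omega> \<in> space P \<Longrightarrow> norm (v n j 0 \<omega>) = 1"
    and start_orth: "\<And>n j q \<omega>. j \<in> {1..k} \<Longrightarrow> q \<in> {1..<j} \<Longrightarrow> \<omega> \<in> space P \<Longrightarrow>
       v n j 0 \<omega> \<bullet> v n q (N n q \<omega>) \<omega> = 0"
    and v_Suc: "\<And>n j i \<omega>. j \<in> {1..k} \<Longrightarrow> \<omega> \<in> space P \<Longrightarrow>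
       v n j (Suc i) \<omega> =
         inner_step f j (\<lambda>q. v n q (N n q \<omega>) \<omega>) (X n \<omega>) (\<alpha>v i) (lv n i) (s n j i \<omega>) (v n j i \<omega>)"
    and X_Suc: "\<And>n \<omega>. \<omega> \<in> space P \<Longrightarrow>
       X (Suc n) \<omega> =
         X n \<omega> - \<alpha> *\<^sub>R
           ((mat 1 - 2 *\<^sub>R gram_outer k (\<lambda>j. v n j (N n j \<omega>) \<omega>)) *v F_est f (X n \<omega>) (r n \<omega>) l)"

text \<open>The almost sure accuracy bound, at every outer iteration, for \<open>V n \<omega>\<close> = the matrix
  \<open>V(n) V(n)\<^sup>T\<close> built from the computed eigenvectors.\<close>

definition eigenvector_accuracy ::
  "'w measure \<Rightarrow> (real^'n \<Rightarrow> real) \<Rightarrow> nat \<Rightarrow> real \<Rightarrow> real \<Rightarrow>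
   (nat \<Rightarrow> 'w \<Rightarrow> real^'n) \<Rightarrow> (nat \<Rightarrow> 'w \<Rightarrow> real^'n^'n) \<Rightarrow> bool" where
  "eigenvector_accuracy P f k l \<theta> X V \<longleftrightarrow>
     (\<forall>n. AE \<omega> in P. \<exists>Q Ql.
        lowest_eigenprojection k (hess f (X n \<omega>)) Q \<and>
        lowest_eigenprojection k (hess (smoothed f l) (X n \<omega>)) Ql \<and>
        min ((onorm (\<lambda>y. (V n \<omega> - Q) *v y))\<^sup>2) ((onorm (\<lambda>y. (V n \<omega> - Ql) *v y))\<^sup>2) \<le> \<theta>)"

definition accuracy_parameters :: "nat \<Rightarrow> nat \<Rightarrow> real \<Rightarrow> real \<Rightarrow> real \<Rightarrow> real \<Rightarrow> bool" where
  "accuracy_parameters d k M \<mu> l \<theta> \<longleftrightarrow>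
     (let \<mu>l = \<mu> - M * l\<^sup>2 * real d / 2 in
        \<theta> > sqrt (2 * real k) * M * l\<^sup>2 * real d / (4 * \<mu>) \<and>
        sqrt (2 * real k) * M * l\<^sup>2 * real d / (4 * \<mu>) > 0 \<and>
        (1 - sqrt \<theta>) * \<mu>l - M * \<theta> - 5 * M * sqrt \<theta> > 0)"

definition trust_region :: "real^'n \<Rightarrow> real \<Rightarrow> real \<Rightarrow> real \<Rightarrow> real \<Rightarrow> (real^'n) set" where
  "trust_region xs M \<mu> \<delta> \<theta> =
     {x. norm (x - xs) \<le> min ((1 - sqrt \<theta>) * \<mu> / M - \<theta> - 5 * sqrt \<theta>) \<delta>}"

definition stays_in :: "'w measure \<Rightarrow> (nat \<Rightarrow> 'w \<Rightarrow> 'b) \<Rightarrow> 'b set \<Rightarrow> 'w set" where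
  "stays_in P X U = {\<omega> \<in> space P. \<forall>n. X n \<omega> \<in> U}"

text \<open>Elementary conditional expectation given an event of positive probability.\<close>

definition cond_expectation :: "'w measure \<Rightarrow> 'w set \<Rightarrow> ('w \<Rightarrow> real) \<Rightarrow> real" where
  "cond_expectation P E g = (LINT \<omega>:E|P. g \<omega>) / measure P E"

end

theory Submission
  imports Defs
begin

text \<open>Write \<open>e = x(n) - x\<^sup>*\<close>, \<open>R = I - 2 V V\<^sup>T\<close> and \<open>g = \<nabla>f(x(n))\<close>.  Taylor expansion to third order
  gives \<open>F(x, r, l) = (g \<bullet> r) r + O(l\<^sup>2 |r|\<^sup>4)\<close>, so no identity for the smoothed gradient is needed:
  since \<open>r\<close> is independent of \<open>x(n)\<close> and \<open>V\<close>, and \<open>E[r r\<^sup>T] = I\<close>, \<open>E[|r|\<^sup>2 r r\<^sup>T] = (d + 2) I\<close>, the step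
  contributes \<open>- 2 \<alpha> e \<bullet> R g\<close> and at most \<open>\<alpha>\<^sup>2 (2 d + 4) M\<^sup>2 |e|\<^sup>2\<close> to \<open>E|e|\<^sup>2\<close>, up to errors
  \<open>\<alpha> (\<eta> |e|\<^sup>2 + O(l\<^sup>4 / \<eta>))\<close> for any \<open>\<eta> > 0\<close>.  On the trust region \<open>e \<bullet> R g \<ge> (c / 2) |e|\<^sup>2\<close> with
  \<open>c = (1 - \<surd>\<theta>) \<mu> - M \<theta> - 5 M \<surd>\<theta>\<close>: if \<open>V V\<^sup>T\<close> is close to the projection of the smoothed Hessian,
  Weyl's inequality and \<open>\<parallel>\<nabla>\<^sup>2f\<^sub>l - \<nabla>\<^sup>2f\<parallel> \<le> M l \<surd>d\<close> transfer the spectral gap.  Restricting to the event that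
  the iterates have stayed in the trust region up to time \<open>n\<close>, which is known before \<open>r(n)\<close> is drawn,
  yields an affine recursion with factor \<open>1 - \<alpha> \<kappa>\<close>, \<open>\<kappa> = c / (2 ((2 d + 4) M\<^sup>2 + 1))\<close>.\<close>

section \<open>Taylor estimates\<close>

text \<open>Neither \<open>f\<close> nor its gradient is assumed bounded, so \<open>f\<close> may
  grow quadratically; Gaussian expectations of it rest on the growth estimate in
  \<open>integrable_dderiv_shift\<close>.\<close>

locale bounded_third_order =
  fixes f :: "real^'n \<Rightarrow> real" and M :: real
  assumes C_3: "C_k 3 f" and M_pos: "0 < M"
    and deriv_norm_le: "\<And>i y. i \<in> {2..3} \<Longrightarrow> deriv_norm i f y \<le> ereal M"
begin

lemma dderiv_differentiable:
  "length us < 3 \<Longrightarrow> dderiv f us differentiable (at x)"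
  using C_3 unfolding C_k_def by blast

lemma dderiv_continuous:
  "length us \<le> 3 \<Longrightarrow> continuous_on UNIV (dderiv f us)"
  using C_3 unfolding C_k_def by blast

lemma dderiv_has_derivative:
  assumes "length us < 3"
  shows "(dderiv f us has_derivative (\<lambda>u. dderiv f (u # us) x)) (at x)"
  using dderiv_differentiable[OF assms, of x] unfolding frechet_derivative_works by simp

lemma dderiv_linear: "length us < 3 \<Longrightarrow> linear (\<lambda>u. dderiv f (u # us) x)"
  using dderiv_has_derivative has_derivative_linear by blast

text \<open>The head of the list is the derivative taken last. With an empty prefix this is
  linearity of a Frechet derivative; each derivative in the prefix \<open>us\<close> is then applied
  to a constant multiple of a function, and the factor passes through it.\<close>

lemma dderiv_scaleR:
  "length us + length vs < 3 \<Longrightarrow>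
    dderiv f (us @ (c *\<^sub>R u) # vs) x = c * dderiv f (us @ u # vs) x"
proof (induction us arbitrary: x)
  case Nil
  then show ?case using linear_scale[OF dderiv_linear[of vs x], of c u] by (simp del: dderiv.simps)
next
  case (Cons a us)
  have eq: "dderiv f (us @ (c *\<^sub>R u) # vs) = (\<lambda>x. c * dderiv f (us @ u # vs) x)"
    using Cons by (intro ext) simp
  have "((\<lambda>x. c * dderiv f (us @ u # vs) x) has_derivative
      (\<lambda>a. c * dderiv f (a # us @ u # vs) x)) (at x)"
    using Cons.prems by (intro has_derivative_mult_right dderiv_has_derivative) simp
  then have "frechet_derivative (\<lambda>x. c * dderiv f (us @ u # vs) x) (at x) =
      (\<lambda>a. c * dderiv f (a # us @ u # vs) x)"
    by (rule frechet_derivative_at[symmetric])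
  then show ?case by (simp add: eq)
qed

text \<open>\<open>deriv_norm\<close> only tests directions in the unit ball, so each slot is
  normalised in turn; in the induction the prefix \<open>us\<close> collects the slots already
  treated. A zero direction does no harm, since \<open>sgn 0 = 0\<close>.\<close>

lemma dderiv_sgn:
  "length us + length vs \<le> 3 \<Longrightarrow>
    dderiv f (us @ vs) x = prod_list (map norm vs) * dderiv f (us @ map sgn vs) x"
proof (induction vs arbitrary: us)
  case (Cons v vs)
  have "v = norm v *\<^sub>R sgn v" by (cases "v = 0") (simp_all add: sgn_div_norm)
  then have "dderiv f (us @ v # vs) x = norm v * dderiv f (us @ sgn v # vs) x"
    using dderiv_scaleR[of us vs "norm v" "sgn v" x] Cons.prems by simp
  also have "dderiv f (us @ sgn v # vs) x =
      prod_list (map norm vs) * dderiv f (us @ map sgn (v # vs)) x"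
    using Cons.IH[of "us @ [sgn v]"] Cons.prems by simp
  finally show ?case by simp
qed simp

lemma dderiv_bound:
  assumes "length us \<in> {2..3}"
  shows "\<bar>dderiv f us x\<bar> \<le> M * prod_list (map norm us)"
proof -
  have "ereal \<bar>dderiv f (map sgn us) x\<bar> \<le> deriv_norm (length us) f x"
    unfolding deriv_norm_def by (intro SUP_upper) (auto simp: norm_sgn)
  also have "\<dots> \<le> ereal M" using deriv_norm_le assms by blast
  finally have *: "\<bar>dderiv f (map sgn us) x\<bar> \<le> M" by simp
  have nn: "0 \<le> prod_list (map norm us)" by (induction us) auto
  have "dderiv f us x = prod_list (map norm us) * dderiv f (map sgn us) x"
    using dderiv_sgn[of "[]" us x] assms by simp
  then show ?thesis using mult_left_mono[OF * nn] nn by (simp add: abs_mult mult.commute)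
qed

lemma dderiv_line:
  assumes "length us < 3"
  shows "((\<lambda>t. dderiv f us (x + t *\<^sub>R u)) has_real_derivative dderiv f (u # us) (x + t *\<^sub>R u)) (at t)"
proof -
  have "((\<lambda>t. x + t *\<^sub>R u) has_derivative (\<lambda>s. s *\<^sub>R u)) (at t)"
    by (auto intro!: derivative_eq_intros)
  then have "((\<lambda>t. dderiv f us (x + t *\<^sub>R u)) has_derivative
      (\<lambda>s. dderiv f ((s *\<^sub>R u) # us) (x + t *\<^sub>R u))) (at t)"
    using has_derivative_compose[OF _ dderiv_has_derivative[OF assms]] by blast
  moreover have "dderiv f ((s *\<^sub>R u) # us) y = dderiv f (u # us) y * s" for s y
    using dderiv_scaleR[of "[]" us s u y] assms by (simp del: dderiv.simps)
  ultimately show ?thesis unfolding has_field_derivative_def by simp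
qed

text \<open>Lagrange remainder on the segment from \<open>x\<close> to \<open>x + u\<close>: each
  differentiation along it puts one more \<open>u\<close> in front of \<open>us\<close>. The
  remainder has total order 2 or 3, the orders for which \<open>M\<close> is a bound.\<close>

lemma dderiv_taylor:
  assumes "0 < m" "length us + m \<le> 3" "2 \<le> length us + m"
  shows "\<bar>dderiv f us (x + u) - (\<Sum>i<m. dderiv f (replicate i u @ us) x / fact i)\<bar>
    \<le> M * norm u ^ m * prod_list (map norm us) / fact m"
proof -
  let ?D = "\<lambda>i t. dderiv f (replicate i u @ us) (x + t *\<^sub>R u)"
  have "\<exists>t>0. t < 1 \<and> ?D 0 1 = (\<Sum>i<m. ?D i 0 / fact i * 1 ^ i) + ?D m t / fact m * 1 ^ m"
  proof (rule Maclaurin)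
    show "\<forall>i t. i < m \<and> 0 \<le> t \<and> t \<le> 1 \<longrightarrow> (?D i has_real_derivative ?D (Suc i) t) (at t)"
      using assms dderiv_line[of "replicate _ u @ us" x u] by (simp del: dderiv.simps)
  qed (use assms in auto)
  then obtain t where
    "?D 0 1 - (\<Sum>i<m. ?D i 0 / fact i) = ?D m t / fact m" by auto
  moreover have "\<bar>?D m t\<bar> \<le> M * (norm u ^ m * prod_list (map norm us))"
    using dderiv_bound[of "replicate m u @ us"] assms by simp
  ultimately show ?thesis by (simp add: abs_divide divide_right_mono mult.assoc)
qed

lemma dderiv_expansion:
  assumes "length us < 3"
  shows "dderiv f (z # us) x = (\<Sum>i\<in>UNIV. z $ i * dderiv f (axis i 1 # us) x)"
proof -
  have "z = (\<Sum>i\<in>UNIV. z $ i *\<^sub>R axis i 1)"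
    using basis_expansion[of z] by (simp add: scalar_mult_eq_scaleR)
  then have "dderiv f (z # us) x = dderiv f ((\<Sum>i\<in>UNIV. z $ i *\<^sub>R axis i 1) # us) x" by simp
  also have "\<dots> = (\<Sum>i\<in>UNIV. dderiv f ((z $ i *\<^sub>R axis i 1) # us) x)"
    using linear_sum[OF dderiv_linear[OF assms], of "\<lambda>i. z $ i *\<^sub>R axis i 1" UNIV x]
    by (simp del: dderiv.simps)
  also have "\<dots> = (\<Sum>i\<in>UNIV. z $ i * dderiv f (axis i 1 # us) x)"
    using dderiv_scaleR[of "[]" us] assms by (simp del: dderiv.simps)
  finally show ?thesis .
qed

lemma inner_grad: "grad f x \<bullet> z = dderiv f [z] x"
  using dderiv_expansion[of "[]" z x] by (simp add: grad_def inner_vec_def mult.commute del: dderiv.simps)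

text \<open>The slot \<open>z\<close> is expanded as an identity of functions, before the outer
  derivative is taken; the slot \<open>y\<close> is linear because it is the direction of that
  derivative.\<close>

lemma dderiv_hess: "dderiv f [y, z] x = y \<bullet> (hess f x *v z)"
proof -
  have "dderiv f [z] = (\<lambda>x. \<Sum>j\<in>UNIV. z $ j * dderiv f [axis j 1] x)"
    by (intro ext dderiv_expansion) simp
  moreover have "((\<lambda>x. \<Sum>j\<in>UNIV. z $ j * dderiv f [axis j 1] x) has_derivative
      (\<lambda>u. \<Sum>j\<in>UNIV. z $ j * dderiv f [u, axis j 1] x)) (at x)"
    by (intro has_derivative_sum has_derivative_mult_right dderiv_has_derivative) simp
  ultimately have "(dderiv f [z] has_derivative (\<lambda>u. \<Sum>j\<in>UNIV. z $ j * dderiv f [u, axis j 1] x)) (at x)"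
    by simp
  then have "frechet_derivative (dderiv f [z]) (at x) = (\<lambda>u. \<Sum>j\<in>UNIV. z $ j * dderiv f [u, axis j 1] x)"
    by (rule frechet_derivative_at[symmetric])
  then have "dderiv f [y, z] x = (\<Sum>j\<in>UNIV. z $ j * dderiv f [y, axis j 1] x)" by simp
  also have "\<dots> = (\<Sum>j\<in>UNIV. z $ j * (\<Sum>i\<in>UNIV. y $ i * dderiv f [axis i 1, axis j 1] x))"
    by (subst dderiv_expansion[of "[_]" y]) (simp_all del: dderiv.simps)
  also have "\<dots> = (\<Sum>j\<in>UNIV. \<Sum>i\<in>UNIV. y $ i * (hess f x $ i $ j * z $ j))"
    by (simp add: hess_def sum_distrib_left mult_ac del: dderiv.simps)
  also have "\<dots> = y \<bullet> (hess f x *v z)"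
    by (subst sum.swap) (simp add: inner_vec_def matrix_vector_mult_def sum_distrib_left)
  finally show ?thesis .
qed

text \<open>The gradient at \<open>x\<close> is tested against itself: the directional derivative
  along this fixed vector vanishes at \<open>xs\<close>, and the second derivative controls its
  growth from there.\<close>

lemma grad_bound:
  assumes "grad f xs = 0"
  shows "norm (grad f x) \<le> M * norm (x - xs)"
proof -
  let ?g = "grad f x"
  have "\<bar>dderiv f [?g] (xs + (x - xs)) - dderiv f [?g] xs\<bar> \<le> M * norm (x - xs) * norm ?g"
    using dderiv_taylor[of 1 "[?g]" xs "x - xs"] by (simp del: dderiv.simps)
  moreover have "dderiv f [?g] xs = 0" using inner_grad[of xs ?g] assms by simp
  ultimately have "norm ?g * norm ?g \<le> M * norm (x - xs) * norm ?g"
    using inner_grad[of x ?g] by (simp del: dderiv.simps add: dot_square_norm power2_eq_square)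
  then show ?thesis
    by (cases "norm ?g = 0") (use M_pos in auto)
qed

text \<open>The Taylor expansion is centred at \<open>x\<close>, not at \<open>xs\<close>, because
  the eigenvectors approximated during a run belong to Hessians at the current iterate.\<close>

lemma grad_hess:
  assumes "grad f xs = 0"
  shows "z \<bullet> grad f x \<ge> (x - xs) \<bullet> (hess f x *v z) - M * (norm (x - xs))\<^sup>2 * norm z / 2"
proof -
  have "\<bar>dderiv f [z] xs - (dderiv f [z] x + dderiv f [xs - x, z] x)\<bar>
      \<le> M * (norm (x - xs))\<^sup>2 * norm z / 2"
    using dderiv_taylor[of 2 "[z]" x "xs - x"]
    by (simp del: dderiv.simps add: numeral_2_eq_2 norm_minus_commute)
  moreover have "dderiv f [z] xs = 0" using inner_grad[of xs z] assms by simp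
  moreover have "dderiv f [xs - x, z] x = - ((x - xs) \<bullet> (hess f x *v z))"
    unfolding dderiv_hess by (metis inner_minus_left minus_diff_eq)
  moreover have "z \<bullet> grad f x = dderiv f [z] x"
    using inner_grad[of x z] by (simp only: inner_commute)
  ultimately show ?thesis by linarith
qed

text \<open>The symmetric difference cancels the terms of order 0 and 2. The two cubic remainders,
  divided by \<open>2 * l\<close> and multiplied by \<open>norm r\<close>, leave an error quadratic
  in \<open>l\<close>.\<close>

lemma F_est_expansion:
  assumes "0 < l"
  shows "norm (F_est f x r l - (grad f x \<bullet> r) *\<^sub>R r) \<le> M * l\<^sup>2 / 6 * norm r ^ 4"
proof -
  let ?u = "l *\<^sub>R r"
  let ?s = "\<lambda>c. dderiv f [] x + c * (l * (grad f x \<bullet> r)) + l\<^sup>2 * dderiv f [r, r] x / 2"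
  \<comment> \<open>The sign \<open>c\<close> treats both evaluation points at once; since its
    square is 1, they share the quadratic term.\<close>
  have t: "\<bar>f (x + (c * l) *\<^sub>R r) - ?s c\<bar> \<le> M * (l ^ 3 * norm r ^ 3) / 6" if "c \<in> {1, -1}" for c
  proof -
    have 1: "dderiv f [(c * l) *\<^sub>R r] x = c * (l * (grad f x \<bullet> r))"
      using dderiv_scaleR[of "[]" "[]" "c * l" r x] by (simp add: inner_grad del: dderiv.simps)
    have "dderiv f [(c * l) *\<^sub>R r, (c * l) *\<^sub>R r] x = (c * l) * ((c * l) * dderiv f [r, r] x)"
      using dderiv_scaleR[of "[]" "[(c * l) *\<^sub>R r]" "c * l" r x]
        dderiv_scaleR[of "[r]" "[]" "c * l" r x]
      by (simp del: dderiv.simps)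
    also have "\<dots> = l\<^sup>2 * dderiv f [r, r] x" using that by (auto simp: power2_eq_square)
    finally have 2: "dderiv f [(c * l) *\<^sub>R r, (c * l) *\<^sub>R r] x = l\<^sup>2 * dderiv f [r, r] x" .
    have "\<bar>dderiv f [] (x + (c * l) *\<^sub>R r) - ?s c\<bar> \<le> M * (norm ((c * l) *\<^sub>R r)) ^ 3 / 6"
      using dderiv_taylor[of 3 "[]" x "(c * l) *\<^sub>R r"] 1 2
      by (simp del: dderiv.simps add: numeral_3_eq_3 numeral_2_eq_2 add_ac fact_numeral)
    then show ?thesis using that assms by (auto simp: power_mult_distrib)
  qed
  let ?a = "f (x + l *\<^sub>R r) - f (x - l *\<^sub>R r) - 2 * l * (grad f x \<bullet> r)"
  have "\<bar>?a\<bar> \<le> 2 * (M * (l ^ 3 * norm r ^ 3) / 6)"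
    using t[of 1] t[of "-1"] unfolding abs_le_iff by (simp del: dderiv.simps)
  then have "\<bar>?a / (2 * l)\<bar> \<le> 2 * (M * (l ^ 3 * norm r ^ 3) / 6) / (2 * l)"
    using assms by (simp only: abs_divide abs_of_pos[of "2 * l"]) (intro divide_right_mono, auto)
  also have "\<dots> = M * l\<^sup>2 / 6 * norm r ^ 3"
    using assms by (simp add: field_simps power2_eq_square power3_eq_cube)
  finally have a: "\<bar>?a / (2 * l)\<bar> \<le> M * l\<^sup>2 / 6 * norm r ^ 3" .
  have "F_est f x r l - (grad f x \<bullet> r) *\<^sub>R r = (?a / (2 * l)) *\<^sub>R r"
    using assms unfolding F_est_def
    by (simp add: scaleR_left_diff_distrib[symmetric] diff_divide_distrib)
  then have "norm (F_est f x r l - (grad f x \<bullet> r) *\<^sub>R r) = \<bar>?a / (2 * l)\<bar> * norm r" by simp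
  also have "\<dots> \<le> M * l\<^sup>2 / 6 * norm r ^ 3 * norm r"
    by (intro mult_right_mono a) simp
  also have "\<dots> = M * l\<^sup>2 / 6 * norm r ^ 4"
    by (simp add: power_eq_if)
  finally show ?thesis .
qed

end

section \<open>Gaussian moments\<close>

definition normal_moment :: "nat \<Rightarrow> real" where
  "normal_moment q = (\<integral>x. std_normal_density x * x ^ q \<partial>lborel)"

lemma integrable_normal_moment:
  "integrable lborel (\<lambda>x. std_normal_density x * x ^ q)"
proof (cases "even q")
  case True
  then show ?thesis using Distributions.normal_moment_even[of 1 0 "q div 2"] by (auto simp: has_bochner_integral_iff)
next
  case False
  then show ?thesis using Distributions.normal_moment_odd[of 1 0 "q div 2"] by (auto simp: has_bochner_integral_iff)
qed

lemma normal_moment_even: "normal_moment (2 * q) = fact (2 * q) / (2 ^ q * fact q)"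
  and normal_moment_odd: "normal_moment (2 * q + 1) = 0"
  using integral_normal_moment_even[of 1 0 q] integral_normal_moment_odd[of 1 0 q]
  by (simp_all add: normal_moment_def)

lemma normal_moment_0 [simp]: "normal_moment 0 = 1"
  using normal_moment_even[of 0] by simp

lemma normal_moment_1 [simp]: "normal_moment (Suc 0) = 0"
  using normal_moment_odd[of 0] by simp

lemma normal_moment_2 [simp]: "normal_moment 2 = 1"
  using normal_moment_even[of 1] by simp

lemma normal_moment_Suc_Suc_0 [simp]: "normal_moment (Suc (Suc 0)) = 1"
  using normal_moment_2 by (simp only: numeral_2_eq_2)

lemma normal_moment_3 [simp]: "normal_moment 3 = 0"
  using normal_moment_odd[of 1] by simp

lemma normal_moment_4 [simp]: "normal_moment 4 = 3"
  using normal_moment_even[of 2] by (simp add: fact_numeral)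

text \<open>Fubini: \<open>lborel\<close> on \<open>real^'n\<close> is the image of a product
  measure indexed by \<open>Basis\<close>. The injection \<open>?e\<close> identifies coordinates
  with basis vectors, and \<open>h'\<close> is \<open>h\<close> re-indexed along it.\<close>

lemma lborel_prod_coordinates:
  fixes h :: "'n::finite \<Rightarrow> real \<Rightarrow> real"
  assumes h: "\<And>i. integrable lborel (h i)"
  shows "has_bochner_integral lborel (\<lambda>x::real^'n. \<Prod>i\<in>UNIV. h i (x $ i)) (\<Prod>i\<in>UNIV. integral\<^sup>L lborel (h i))"
proof -
  interpret product_sigma_finite "\<lambda>b::real^'n. lborel :: real measure" ..
  let ?B = "Basis :: (real^'n) set"
  let ?P = "\<Pi>\<^sub>M b\<in>?B. (lborel :: real measure)"
  let ?e = "\<lambda>i. axis i 1 :: real^'n"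
  have B: "?B = range ?e" by (auto simp: Basis_vec_def)
  have inj: "inj ?e" by (auto simp: inj_on_def axis_eq_axis)
  define h' where "h' b = h (inv ?e b)" for b
  have h'[simp]: "h' (?e i) = h i" for i by (simp add: h'_def inv_f_f[OF inj])
  have m: "h i \<in> borel_measurable borel" for i using h[of i] by auto
  have int': "\<And>b. b \<in> ?B \<Longrightarrow> integrable lborel (h' b)" using h by (auto simp: h'_def)
  have coord: "(\<Sum>b\<in>?B. g b *\<^sub>R b) $ i = g (?e i)" for g i
  proof -
    have "(\<Sum>b\<in>?B. g b *\<^sub>R b) $ i = (\<Sum>j\<in>UNIV. g (?e j) * ?e j $ i)"
      unfolding B by (simp add: sum.reindex[OF inj])
    also have "\<dots> = (\<Sum>j\<in>UNIV. if j = i then g (?e i) else 0)"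
      by (intro sum.cong) (auto simp: axis_def)
    finally show ?thesis by simp
  qed
  have eq: "(\<Prod>i\<in>UNIV. h i ((\<Sum>b\<in>?B. g b *\<^sub>R b) $ i)) = (\<Prod>b\<in>?B. h' b (g b))" for g
    unfolding coord unfolding B by (simp add: prod.reindex[OF inj])
  have "has_bochner_integral ?P (\<lambda>g. \<Prod>b\<in>?B. h' b (g b)) (\<Prod>b\<in>?B. integral\<^sup>L lborel (h' b))"
    using product_integrable_prod[OF _ int'] product_integral_prod[OF _ int']
    by (simp add: has_bochner_integral_iff)
  also have "(\<Prod>b\<in>?B. integral\<^sup>L lborel (h' b)) = (\<Prod>i\<in>UNIV. integral\<^sup>L lborel (h i))"
    unfolding B by (simp add: prod.reindex[OF inj])
  finally show ?thesis
    unfolding eq[symmetric] lborel_eq[where 'a = "real^'n"]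
    using m by (subst has_bochner_integral_distr) (auto intro!: borel_measurable_sum)
qed

text \<open>The Gaussian density is itself a product over coordinates, so it merges with the
  monomial into one-dimensional factors. All Gaussian moments below are derived from this
  one.\<close>

lemma has_bochner_integral_gaussian_monomial:
  fixes p :: "'n::finite \<Rightarrow> nat"
  shows "has_bochner_integral std_gaussian (\<lambda>x::real^'n. \<Prod>i\<in>UNIV. (x $ i) ^ p i)
    (\<Prod>i\<in>UNIV. normal_moment (p i))"
proof -
  have "has_bochner_integral lborel
      (\<lambda>x::real^'n. \<Prod>i\<in>UNIV. std_normal_density (x $ i) * (x $ i) ^ p i) (\<Prod>i\<in>UNIV. normal_moment (p i))"
    unfolding normal_moment_def by (rule lborel_prod_coordinates[OF integrable_normal_moment])
  then show ?thesis unfolding std_gaussian_def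
    by (intro has_bochner_integral_density) (auto simp: prod.distrib prod_nonneg)
qed

lemma space_std_gaussian [simp]: "space std_gaussian = UNIV"
  and sets_std_gaussian [simp, measurable_cong]: "sets (std_gaussian :: (real^'n::finite) measure) = sets borel"
  by (simp_all add: std_gaussian_def)

lemma prob_space_std_gaussian: "prob_space (std_gaussian :: (real^'n::finite) measure)"
proof
  have "has_bochner_integral (std_gaussian :: (real^'n) measure) (\<lambda>x. 1::real) 1"
    using has_bochner_integral_gaussian_monomial[of "\<lambda>i::'n. 0"] by simp
  then have "integrable (std_gaussian :: (real^'n) measure) (\<lambda>x. 1::real)"
    and 1: "integral\<^sup>L (std_gaussian :: (real^'n) measure) (\<lambda>x. 1::real) = 1"
    by (auto simp: has_bochner_integral_iff)
  then have "(\<integral>\<^sup>+x. ennreal 1 \<partial>(std_gaussian :: (real^'n) measure)) = ennreal 1"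
    by (subst nn_integral_eq_integral) auto
  then show "emeasure (std_gaussian :: (real^'n) measure) (space std_gaussian) = 1" by simp
qed

text \<open>The squared norm is a sum of squared coordinates, each of which raises one exponent by
  2. The monomial factor is there to make the induction on \<open>q\<close> close.\<close>

lemma integrable_gaussian_norm_even_monomial:
  fixes p :: "'n::finite \<Rightarrow> nat"
  shows "integrable std_gaussian (\<lambda>x::real^'n. norm x ^ (2 * q) * (\<Prod>i\<in>UNIV. (x $ i) ^ p i))"
proof (induction q arbitrary: p)
  case 0
  show ?case using has_bochner_integral_gaussian_monomial[of p] by (simp add: has_bochner_integral_iff)
next
  case (Suc q)
  have "norm x ^ (2 * Suc q) * (\<Prod>i\<in>UNIV. (x $ i) ^ p i) =
      (\<Sum>j\<in>UNIV. norm x ^ (2 * q) * (\<Prod>i\<in>UNIV. (x $ i) ^ (p i + (if i = j then 2 else 0))))"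
    for x :: "real^'n"
  proof -
    have "(norm x)\<^sup>2 = (\<Sum>j\<in>UNIV. (x $ j)\<^sup>2)"
      unfolding power2_norm_eq_inner by (simp add: inner_vec_def power2_eq_square)
    moreover have "(\<Prod>i\<in>UNIV. (x $ i) ^ (p i + (if i = j then 2 else 0))) =
        (\<Prod>i\<in>UNIV. (x $ i) ^ p i) * (x $ j)\<^sup>2" for j
    proof -
      have "(\<Prod>i\<in>UNIV. (x $ i) ^ (if i = j then 2 else 0)) = (\<Prod>i\<in>UNIV. if i = j then (x $ i)\<^sup>2 else 1)"
        by (intro prod.cong) auto
      then show ?thesis by (simp add: power_add prod.distrib)
    qed
    moreover have "norm x ^ (2 * Suc q) = norm x ^ (2 * q) * (norm x)\<^sup>2"
      by (simp add: power_add[symmetric])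
    ultimately show ?thesis
      by (simp only: sum_distrib_left sum_distrib_right) (simp add: mult_ac)
  qed
  then show ?case using Suc.IH by (simp del: mult_Suc_right)
qed

text \<open>Odd powers of the norm are not polynomials, so they are dominated by even ones via
  \<open>2 t \<le> 1 + t\<^sup>2\<close>.\<close>

lemma integrable_gaussian_norm_power:
  "integrable std_gaussian (\<lambda>x::real^'n::finite. norm x ^ q)"
proof -
  interpret prob_space "std_gaussian :: (real^'n) measure" by (rule prob_space_std_gaussian)
  have "integrable std_gaussian (\<lambda>x::real^'n. 1 + norm x ^ (2 * q))"
    using integrable_gaussian_norm_even_monomial[of q "\<lambda>i::'n. 0"] by simp
  then show ?thesis
  proof (rule Bochner_Integration.integrable_bound)
    have "norm x ^ q \<le> 1 + norm x ^ (2 * q)" for x :: "real^'n"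
    proof -
      have "0 \<le> (norm x ^ q - 1)\<^sup>2" by simp
      then have "2 * norm x ^ q \<le> 1 + norm x ^ (2 * q)"
        by (simp add: power2_diff power_mult[symmetric] mult.commute)
      moreover have "0 \<le> norm x ^ q" by simp
      ultimately show ?thesis by linarith
    qed
    then show "AE x in std_gaussian. norm (norm (x::real^'n) ^ q) \<le> norm (1 + norm x ^ (2 * q))"
      by (intro AE_I2) (simp add: abs_of_nonneg)
  qed simp
qed

lemma has_bochner_integral_gaussian_pair:
  "has_bochner_integral std_gaussian (\<lambda>x::real^'n::finite. x $ i * x $ j) (if i = j then 1 else 0)"
proof -
  \<comment> \<open>The exponent vector of \<open>x $ i * x $ j\<close>; as a sum of two indicators
    it also covers \<open>i = j\<close>. Off the diagonal a vanishing first moment occurs.\<close>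
  let ?p = "\<lambda>a. (if a = i then 1 else 0) + (if a = j then 1 else 0 :: nat)"
  have "(\<Prod>a\<in>UNIV. (x $ a) ^ ?p a) = x $ i * x $ j" for x :: "real^'n"
    by (simp add: power_add prod.distrib if_distrib[of "\<lambda>m. _ ^ m"] cong: if_cong)
  moreover have "(\<Prod>a\<in>UNIV. normal_moment (?p a)) = (if i = j then 1 else 0)"
  proof (cases "i = j")
    case True
    then have "normal_moment (?p a) = 1" for a by simp
    then show ?thesis using True by simp
  next
    case False
    then have "normal_moment (?p i) = 0" by simp
    then have "\<exists>a\<in>UNIV. normal_moment (?p a) = 0" by blast
    then show ?thesis using False by (subst prod_zero) auto
  qed
  ultimately show ?thesis using has_bochner_integral_gaussian_monomial[of ?p] by simp
qed

text \<open>After expanding the squared norm, the diagonal case consists of one fourth moment, equal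
  to 3, and \<open>d - 1\<close> products of second moments, in total \<open>d + 2\<close>. Off the
  diagonal coordinate \<open>i\<close> has exponent 1 or 3, and odd moments vanish.\<close>

lemma has_bochner_integral_gaussian_norm_pair:
  "has_bochner_integral std_gaussian (\<lambda>x::real^'n::finite. (norm x)\<^sup>2 * (x $ i * x $ j))
    (if i = j then real CARD('n) + 2 else 0)"
proof -
  let ?p = "\<lambda>b a. (if a = i then 1 else 0) + ((if a = j then 1 else 0) + (if a = b then 2 else 0 :: nat))"
  have eq: "(\<Sum>b\<in>UNIV. \<Prod>a\<in>UNIV. (x $ a) ^ ?p b a) = (norm x)\<^sup>2 * (x $ i * x $ j)" for x :: "real^'n"
  proof -
    have "(\<Prod>a\<in>UNIV. (x $ a) ^ ?p b a) = x $ i * (x $ j * (x $ b)\<^sup>2)" for b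
      by (simp add: power_add prod.distrib if_distrib[of "\<lambda>m. _ ^ m"] cong: if_cong)
    moreover have "(norm x)\<^sup>2 = (\<Sum>b\<in>UNIV. (x $ b)\<^sup>2)"
      unfolding power2_norm_eq_inner by (simp add: inner_vec_def power2_eq_square)
    ultimately show ?thesis by (simp add: sum_distrib_left mult_ac)
  qed
  have val: "(\<Prod>a\<in>UNIV. normal_moment (?p b a)) = (if i = j then if b = i then 3 else 1 else 0)" for b
  proof (cases "i = j")
    case True
    then have "normal_moment (?p b a) = (if a = i then if b = i then 3 else 1 else 1)" for a
      by simp
    then show ?thesis using True by simp
  next
    case False
    then have "normal_moment (?p b i) = 0" by simp
    then have "\<exists>a\<in>UNIV. normal_moment (?p b a) = 0" by blast
    then show ?thesis using False by (subst prod_zero) auto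
  qed
  have "(\<Sum>b\<in>UNIV. if b = i then 3 else 1 :: real) = (\<Sum>b\<in>UNIV. 1 + (if b = i then 2 else 0))"
    by (intro sum.cong) auto
  also have "\<dots> = real CARD('n) + 2" by (subst sum.distrib) simp
  finally have s: "(\<Sum>b\<in>UNIV. if i = j then if b = i then 3 else 1 else 0 :: real) =
      (if i = j then real CARD('n) + 2 else 0)" by auto
  have "has_bochner_integral std_gaussian (\<lambda>x::real^'n. \<Sum>b\<in>UNIV. \<Prod>a\<in>UNIV. (x $ a) ^ ?p b a)
      (\<Sum>b\<in>UNIV. \<Prod>a\<in>UNIV. normal_moment (?p b a))"
    by (intro has_bochner_integral_sum has_bochner_integral_gaussian_monomial)
  then show ?thesis unfolding eq val s .
qed

text \<open>The variance of the norm is nonnegative and its second moment is the dimension.\<close>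

lemma gaussian_norm_le: "integral\<^sup>L std_gaussian (\<lambda>x::real^'n::finite. norm x) \<le> sqrt (real CARD('n))"
proof -
  let ?d = "real CARD('n)"
  interpret prob_space "std_gaussian :: (real^'n) measure" by (rule prob_space_std_gaussian)
  have "has_bochner_integral std_gaussian (\<lambda>x::real^'n. \<Sum>i\<in>UNIV. x $ i * x $ i) (\<Sum>i\<in>(UNIV::'n set). 1)"
    using has_bochner_integral_gaussian_pair[of i i for i :: 'n]
    by (intro has_bochner_integral_sum) simp
  then have sq: "integral\<^sup>L std_gaussian (\<lambda>x::real^'n. (norm x)\<^sup>2) = ?d"
    unfolding power2_norm_eq_inner by (simp add: has_bochner_integral_iff inner_vec_def)
  have int: "integrable std_gaussian (\<lambda>x::real^'n. norm x)"
    "integrable std_gaussian (\<lambda>x::real^'n. (norm x)\<^sup>2)"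
    using integrable_gaussian_norm_power[of 1] integrable_gaussian_norm_power[of 2] by auto
  have "variance (\<lambda>x::real^'n. norm x) = integral\<^sup>L std_gaussian (\<lambda>x::real^'n. (norm x)\<^sup>2)
      - (integral\<^sup>L std_gaussian (\<lambda>x::real^'n. norm x))\<^sup>2"
    using int by (rule variance_eq)
  then have "(integral\<^sup>L std_gaussian (\<lambda>x::real^'n. norm x))\<^sup>2 \<le> ?d"
    using variance_positive[of "\<lambda>x::real^'n. norm x"] sq by linarith
  then show ?thesis by (rule real_le_rsqrt)
qed

section \<open>Eigenvalues and reflections\<close>

text \<open>The characteristic polynomial determines the multiset of its roots, and a multiset has
  only one sorted list. This links the eigenvalues in \<open>eigenvalue_assumption\<close> with
  those hidden in \<open>lowest_eigenprojection\<close>.\<close>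

lemma sorted_eigenvalues_unique:
  fixes A :: "real^'n^'n"
  assumes "sorted_eigenvalues A lam" "sorted_eigenvalues A lam'" "i \<in> {1..CARD('n)}"
  shows "lam i = lam' i"
proof -
  let ?d = "CARD('n)"
  let ?p = "\<lambda>lam. \<Prod>i = 1..?d. [:- lam i, 1 :: real:]"
  let ?xs = "\<lambda>lam. map lam [1..<Suc ?d]"
  have "poly (?p lam) t = poly (?p lam') t" for t
    using assms unfolding sorted_eigenvalues_def by (simp add: poly_prod)
  then have "?p lam = ?p lam'" unfolding poly_eq_poly_eq_iff[symmetric] by blast
  moreover have "proots (?p lam) = mset (?xs lam)" for lam
  proof -
    have "proots (?p lam) = (\<Sum>i = 1..?d. {#lam i#})" by (subst proots_prod) auto
    also have "\<dots> = image_mset lam (mset_set {1..?d})"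
      by (simp add: sum_unfold_sum_mset)
    also have "\<dots> = mset (?xs lam)"
      by (simp add: atLeastLessThanSuc_atLeastAtMost del: upt_Suc)
    finally show ?thesis .
  qed
  ultimately have m: "mset (?xs lam) = mset (?xs lam')" by metis
  have s: "sorted (?xs lam)" if "sorted_eigenvalues A lam" for lam
    unfolding sorted_iff_nth_mono
  proof (intro allI impI)
    fix a b assume "a \<le> b" "b < length (?xs lam)"
    then show "?xs lam ! a \<le> ?xs lam ! b"
      using that mono_onD[of "{1..?d}" lam "Suc a" "Suc b"]
      by (simp add: sorted_eigenvalues_def del: upt_Suc)
  qed
  have "?xs lam = ?xs lam'"
    using properties_for_sort[OF m s[OF assms(1)]] properties_for_sort[OF refl s[OF assms(2)]] by simp
  then have "\<forall>i\<in>set [1..<Suc ?d]. lam i = lam' i" by (simp only: map_eq_conv)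
  then show ?thesis using assms(3) by (auto simp del: upt_Suc)
qed

lemma gram_outer_mult: "gram_outer k v *v x = (\<Sum>j = 1..k. (x \<bullet> v j) *\<^sub>R v j)"
  by (simp add: vec_eq_iff gram_outer_def matrix_vector_mult_def inner_vec_def
      sum_distrib_left sum_distrib_right mult_ac) (subst sum.swap, simp add: mult_ac)

lemma gram_outer_symmetric: "(gram_outer k v *v x) \<bullet> y = x \<bullet> (gram_outer k v *v y)"
  by (simp add: gram_outer_mult inner_sum_left inner_sum_right inner_commute mult_ac)

text \<open>For the orthogonal projection \<open>?Px\<close> of \<open>x\<close>,
  \<open>?Px \<bullet> ?Px = x \<bullet> ?Px\<close>, so the two correction terms in the squared
  norm cancel.\<close>

lemma norm_reflection:
  assumes "\<And>i j. i \<in> {1..k} \<Longrightarrow> j \<in> {1..k} \<Longrightarrow> w i \<bullet> w j = (if i = j then 1 else 0)"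
  shows "norm (x - 2 *\<^sub>R (gram_outer k w *v x)) = norm x"
proof -
  let ?Px = "gram_outer k w *v x"
  have "?Px \<bullet> w j = x \<bullet> w j" if "j \<in> {1..k}" for j
  proof -
    have "?Px \<bullet> w j = (\<Sum>i = 1..k. if i = j then x \<bullet> w j else 0)"
      unfolding gram_outer_mult inner_sum_left by (intro sum.cong) (use assms that in auto)
    then show ?thesis using that by simp
  qed
  moreover have "y \<bullet> ?Px = (\<Sum>j = 1..k. (x \<bullet> w j) * (y \<bullet> w j))" for y
    by (simp add: gram_outer_mult inner_sum_right)
  ultimately have "?Px \<bullet> ?Px = x \<bullet> ?Px" by simp
  then have "(norm (x - 2 *\<^sub>R ?Px))\<^sup>2 = (norm x)\<^sup>2"
    unfolding power2_norm_eq_inner by (simp add: inner_diff_left inner_diff_right inner_commute)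
  then show ?thesis by simp
qed

section \<open>Quadratic forms in an orthonormal eigenbasis\<close>

locale orthonormal_eigenbasis =
  fixes A :: "real^'n^'n" and lam :: "nat \<Rightarrow> real" and u :: "nat \<Rightarrow> real^'n"
  assumes eigen: "i \<in> {1..CARD('n)} \<Longrightarrow> A *v u i = lam i *\<^sub>R u i"
    and orthonormal: "i \<in> {1..CARD('n)} \<Longrightarrow> j \<in> {1..CARD('n)} \<Longrightarrow> u i \<bullet> u j = (if i = j then 1 else 0)"
    and mono: "mono_on {1..CARD('n)} lam"
begin

lemma inj: "inj_on u {1..CARD('n)}"
  using orthonormal by (metis inj_onI zero_neq_one)

lemma independent_image:
  assumes "J \<subseteq> {1..CARD('n)}"
  shows "independent (u ` J)"
proof (rule pairwise_orthogonal_independent)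
  show "pairwise orthogonal (u ` J)"
    using orthonormal assms by (auto simp: pairwise_def orthogonal_def subset_iff)
  show "0 \<notin> u ` J"
    using orthonormal assms by (force simp: subset_iff)
qed

lemma dim_image:
  assumes "J \<subseteq> {1..CARD('n)}"
  shows "dim (span (u ` J)) = card J"
  using dim_span_eq_card_independent[OF independent_image[OF assms]]
    card_image[OF inj_on_subset[OF inj assms]] by simp

lemma expand: "x = (\<Sum>i = 1..CARD('n). (x \<bullet> u i) *\<^sub>R u i)"
proof -
  let ?B = "u ` {1..CARD('n)}"
  have "dim ?B = DIM(real^'n)" using dim_image[of "{1..CARD('n)}"] by simp
  then have "x \<in> span ?B" using dim_eq_full[of ?B] by blast
  then have "(\<Sum>v\<in>?B. (x \<bullet> v) *\<^sub>R v) = x"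
    by (intro orthonormal_basis_expand)
      (auto simp: pairwise_def orthogonal_def orthonormal norm_eq_1)
  then show ?thesis unfolding sum.reindex[OF inj] by simp
qed

lemma bilinear_expand: "y \<bullet> (A *v x) = (\<Sum>i = 1..CARD('n). lam i * (x \<bullet> u i) * (y \<bullet> u i))"
proof -
  have "A *v x = A *v (\<Sum>i = 1..CARD('n). (x \<bullet> u i) *\<^sub>R u i)" using expand by metis
  also have "\<dots> = (\<Sum>i = 1..CARD('n). (x \<bullet> u i) *\<^sub>R (A *v u i))"
    by (simp add: linear_sum[OF matrix_vector_mul_linear] matrix_vector_mult_scaleR)
  also have "\<dots> = (\<Sum>i = 1..CARD('n). ((x \<bullet> u i) * lam i) *\<^sub>R u i)"
    by (intro sum.cong) (simp_all add: eigen)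
  finally show ?thesis by (simp add: inner_sum_right mult_ac)
qed

lemma symmetric: "y \<bullet> (A *v x) = x \<bullet> (A *v y)"
  unfolding bilinear_expand by (simp add: mult_ac)

lemma norm_expand: "(norm x)\<^sup>2 = (\<Sum>i = 1..CARD('n). (x \<bullet> u i)\<^sup>2)"
proof -
  have "x \<bullet> x = x \<bullet> (\<Sum>i = 1..CARD('n). (x \<bullet> u i) *\<^sub>R u i)" using expand by metis
  then show ?thesis
    unfolding power2_norm_eq_inner by (simp add: inner_sum_right power2_eq_square)
qed

lemma orthogonal_span:
  assumes "J \<subseteq> {1..CARD('n)}" "x \<in> span (u ` J)" "i \<in> {1..CARD('n)} - J"
  shows "x \<bullet> u i = 0"
  using assms(2)
proof (induction rule: span_induct)
  case base
  show ?case using subspace_hyperplane[of "u i"] by (simp add: inner_commute)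
next
  case (step x)
  then show ?case using assms(1,3) orthonormal by (auto simp: subset_iff)
qed

text \<open>One half of the Courant-Fischer principle: on this span the coordinates beyond
  \<open>m\<close> vanish, and the others carry weights at most \<open>lam m\<close>.\<close>

lemma quadratic_le:
  assumes "m \<in> {1..CARD('n)}" "x \<in> span (u ` {1..m})"
  shows "x \<bullet> (A *v x) \<le> lam m * (norm x)\<^sup>2"
  unfolding bilinear_expand norm_expand sum_distrib_left
proof (rule sum_mono)
  fix i assume i: "i \<in> {1..CARD('n)}"
  show "lam i * (x \<bullet> u i) * (x \<bullet> u i) \<le> lam m * (x \<bullet> u i)\<^sup>2"
  proof (cases "i \<le> m")
    case True
    then have "lam i \<le> lam m" using mono_onD[OF mono] i assms(1) by blast
    from mult_right_mono[OF this, of "(x \<bullet> u i)\<^sup>2"] show ?thesis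
      by (simp add: power2_eq_square mult.assoc)
  next
    case False
    then show ?thesis using orthogonal_span[of "{1..m}" x i] i assms by auto
  qed
qed

lemma quadratic_ge:
  assumes "m \<in> {1..CARD('n)}" "x \<in> span (u ` {m..CARD('n)})"
  shows "lam m * (norm x)\<^sup>2 \<le> x \<bullet> (A *v x)"
  unfolding bilinear_expand norm_expand sum_distrib_left
proof (rule sum_mono)
  fix i assume i: "i \<in> {1..CARD('n)}"
  show "lam m * (x \<bullet> u i)\<^sup>2 \<le> lam i * (x \<bullet> u i) * (x \<bullet> u i)"
  proof (cases "m \<le> i")
    case True
    then have "lam m \<le> lam i" using mono_onD[OF mono] i assms(1) by blast
    from mult_right_mono[OF this, of "(x \<bullet> u i)\<^sup>2"] show ?thesis
      by (simp add: power2_eq_square mult.assoc)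
  next
    case False
    then show ?thesis using orthogonal_span[of "{m..CARD('n)}" x i] i assms by auto
  qed
qed

lemma reflection_component:
  assumes "k \<le> CARD('n)" "i \<in> {1..CARD('n)}"
  shows "(x - 2 *\<^sub>R (gram_outer k u *v x)) \<bullet> u i = (if i \<le> k then - 1 else 1) * (x \<bullet> u i)"
proof -
  have "(gram_outer k u *v x) \<bullet> u i = (\<Sum>j = 1..k. if j = i then x \<bullet> u i else 0)"
    unfolding gram_outer_mult inner_sum_left
    by (intro sum.cong) (use assms orthonormal in auto)
  then show ?thesis using assms(2) by (simp add: inner_diff_left)
qed

text \<open>The reflection flips the sign of exactly the \<open>k\<close> components with negative
  eigenvalues, so every term of the expanded form has weight at least \<open>c\<close>. This is how
  the search turns the saddle into an attracting point.\<close>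

lemma reflection_quadratic_ge:
  assumes "k \<in> {1..<CARD('n)}" "lam k \<le> - c" "c \<le> lam (k + 1)"
  shows "c * (norm x)\<^sup>2 \<le> (x - 2 *\<^sub>R (gram_outer k u *v x)) \<bullet> (A *v x)"
  unfolding bilinear_expand norm_expand sum_distrib_left
proof (rule sum_mono)
  fix i assume i: "i \<in> {1..CARD('n)}"
  have c: "c \<le> (if i \<le> k then - lam i else lam i)"
  proof (cases "i \<le> k")
    case True
    then have "lam i \<le> lam k" using mono_onD[OF mono, of i k] i assms(1) by simp
    then show ?thesis using True assms(2) by simp
  next
    case False
    then have "lam (k + 1) \<le> lam i" using mono_onD[OF mono, of "k + 1" i] i assms(1) by simp
    then show ?thesis using False assms(3) by simp
  qed
  have "k \<le> CARD('n)" using assms(1) by simp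
  note comp = reflection_component[OF this i, of x]
  from mult_right_mono[OF c, of "(x \<bullet> u i)\<^sup>2"]
  show "c * (x \<bullet> u i)\<^sup>2 \<le> lam i * (x \<bullet> u i) * ((x - 2 *\<^sub>R (gram_outer k u *v x)) \<bullet> u i)"
    unfolding comp by (auto simp: power2_eq_square mult_ac split: if_splits)
qed

end

text \<open>Weyl's inequality by dimension counting: a nonzero vector lies both in the span of the
  eigenvectors \<open>1..m\<close> of \<open>B\<close> and in the span of the eigenvectors \<open>m..d\<close> of \<open>A\<close>.\<close>

lemma eigenvalue_perturbation:
  fixes A B :: "real^'n^'n"
  assumes A: "orthonormal_eigenbasis A lam u" and B: "orthonormal_eigenbasis B kap w"
    and le: "\<And>x. x \<bullet> (A *v x) \<le> x \<bullet> (B *v x) + b * (norm x)\<^sup>2"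
    and m: "m \<in> {1..CARD('n)}"
  shows "lam m \<le> kap m + b"
proof -
  interpret A: orthonormal_eigenbasis A lam u by fact
  interpret B: orthonormal_eigenbasis B kap w by fact
  let ?S = "span (w ` {1..m})" and ?T = "span (u ` {m..CARD('n)})"
  have "dim ?S = m" using B.dim_image[of "{1..m}"] m by simp
  moreover have "dim ?T = CARD('n) + 1 - m" using A.dim_image[of "{m..CARD('n)}"] m by simp
  moreover have "dim {x + y |x y. x \<in> ?S \<and> y \<in> ?T} + dim (?S \<inter> ?T) = dim ?S + dim ?T"
    by (intro dim_sums_Int subspace_span)
  moreover have "dim {x + y |x y. x \<in> ?S \<and> y \<in> ?T} \<le> CARD('n)"
    using dim_subset_UNIV[of "{x + y |x y. x \<in> ?S \<and> y \<in> ?T}"] by simp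
  ultimately have "dim (?S \<inter> ?T) \<noteq> 0" using m by (simp del: dim_eq_0 dim_span)
  then obtain y where y: "y \<in> ?S" "y \<in> ?T" "y \<noteq> 0" unfolding dim_eq_0 by blast
  have "lam m * (norm y)\<^sup>2 \<le> (kap m + b) * (norm y)\<^sup>2"
    using A.quadratic_ge[OF m y(2)] B.quadratic_le[OF m y(1)] le[of y] by (simp add: distrib_right)
  then show ?thesis using y(3) by simp
qed

lemma lowest_eigenprojectionE:
  fixes A :: "real^'n^'n"
  assumes "lowest_eigenprojection k A Q"
  obtains lam u where "orthonormal_eigenbasis A lam u" "sorted_eigenvalues A lam" "Q = gram_outer k u"
  using assms unfolding lowest_eigenprojection_def orthonormal_eigenbasis_def sorted_eigenvalues_def
  by blast

text \<open>With \<open>p\<close> the exact eigenbasis to which \<open>V\<close> is close, the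
  right-hand side splits into the reflected \<open>e\<close> paired with the gradient, and an error
  from \<open>V - gram_outer k p\<close> of size \<open>2 M \<surd>\<theta>\<close>. The first part
  becomes a Hessian form by \<open>grad_hess\<close>, at cost \<open>M * norm e / 2\<close>. The
  loss \<open>2 * b\<close> arises for the projection of \<open>Hl\<close>: one \<open>b\<close> for
  its eigenvalues, one for replacing \<open>Hl\<close> by the Hessian in the form.\<close>

lemma (in bounded_third_order) reflected_gradient_ge:
  fixes V Q Ql Hl :: "real^'n^'n"
  assumes xs: "grad f xs = 0" and k: "k \<in> {1..<CARD('n)}"
    and lam: "sorted_eigenvalues (hess f x) lam" "lam k \<le> - \<mu>" "\<mu> \<le> lam (k + 1)"
    and Q: "lowest_eigenprojection k (hess f x) Q" and Ql: "lowest_eigenprojection k Hl Ql"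
    and acc: "min ((onorm (\<lambda>y. (V - Q) *v y))\<^sup>2) ((onorm (\<lambda>y. (V - Ql) *v y))\<^sup>2) \<le> \<theta>"
    and b: "0 \<le> b" "\<And>y z. \<bar>y \<bullet> (Hl *v z) - y \<bullet> (hess f x *v z)\<bar> \<le> b * norm y * norm z"
  shows "(\<mu> - 2 * b - M * norm (x - xs) / 2 - 2 * M * sqrt \<theta>) * (norm (x - xs))\<^sup>2
    \<le> (x - xs) \<bullet> ((mat 1 - 2 *\<^sub>R V) *v grad f x)"
proof -
  define e g H where "e = x - xs" and "g = grad f x" and "H = hess f x"
  note [simp] = e_def[symmetric] g_def[symmetric] H_def[symmetric]
  obtain lam' u where u: "orthonormal_eigenbasis H lam' u" "sorted_eigenvalues H lam'" "Q = gram_outer k u"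
    using Q by (auto elim: lowest_eigenprojectionE)
  interpret H: orthonormal_eigenbasis H lam' u by fact
  \<comment> \<open>The gap is assumed for \<open>lam\<close>, while the eigenbasis comes with
    \<open>lam'\<close>; sorted eigenvalues are unique.\<close>
  have lam': "lam' k \<le> - \<mu>" "\<mu> \<le> lam' (k + 1)"
    using sorted_eigenvalues_unique[of H lam lam' k] sorted_eigenvalues_unique[of H lam lam' "k + 1"] k u lam by auto
  obtain kap w where w: "orthonormal_eigenbasis Hl kap w" "Ql = gram_outer k w"
    using Ql by (auto elim: lowest_eigenprojectionE)
  interpret Hl: orthonormal_eigenbasis Hl kap w by fact
  have b': "\<bar>y \<bullet> (Hl *v y) - y \<bullet> (H *v y)\<bar> \<le> b * (norm y)\<^sup>2" for y
    using b(2)[of y y] by (simp add: power2_eq_square mult.assoc)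
  have "kap k \<le> lam' k + b"
    by (rule eigenvalue_perturbation[OF w(1) u(1)]) (use b' k in \<open>auto simp: abs_le_iff algebra_simps\<close>)
  moreover have "lam' (k + 1) \<le> kap (k + 1) + b"
    by (rule eigenvalue_perturbation[OF u(1) w(1)]) (use b' k in \<open>auto simp: abs_le_iff algebra_simps\<close>)
  ultimately have kap: "kap k \<le> - (\<mu> - b)" "\<mu> - b \<le> kap (k + 1)" using lam' by auto
  \<comment> \<open>The witness is \<open>u\<close> or \<open>w\<close>, whichever attains the
    accuracy; the constant \<open>\<mu> - 2 * b\<close> is weak enough for both.\<close>
  have "\<exists>p. (onorm (\<lambda>y. (V - gram_outer k p) *v y))\<^sup>2 \<le> \<theta> \<and>
      norm (e - 2 *\<^sub>R (gram_outer k p *v e)) = norm e \<and>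
      (\<mu> - 2 * b) * (norm e)\<^sup>2 \<le> (e - 2 *\<^sub>R (gram_outer k p *v e)) \<bullet> (H *v e)"
  proof (cases "(onorm (\<lambda>y. (V - Q) *v y))\<^sup>2 \<le> \<theta>")
    case True
    have "(\<mu> - 2 * b) * (norm e)\<^sup>2 \<le> \<mu> * (norm e)\<^sup>2"
      using b(1) by (intro mult_right_mono) auto
    then show ?thesis
      using True u(3) norm_reflection[of k u e] H.orthonormal H.reflection_quadratic_ge[OF k lam', of e] k
      by (intro exI[of _ u]) auto
  next
    case False
    let ?z = "e - 2 *\<^sub>R (gram_outer k w *v e)"
    have n: "norm ?z = norm e" using k by (intro norm_reflection Hl.orthonormal) auto
    have "(\<mu> - b) * (norm e)\<^sup>2 \<le> ?z \<bullet> (Hl *v e)"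
      by (rule Hl.reflection_quadratic_ge[OF k kap])
    moreover have "\<bar>?z \<bullet> (Hl *v e) - ?z \<bullet> (H *v e)\<bar> \<le> b * (norm e)\<^sup>2"
      using b(2)[of ?z e] n by (simp add: power2_eq_square mult.assoc)
    ultimately have "(\<mu> - 2 * b) * (norm e)\<^sup>2 \<le> ?z \<bullet> (H *v e)"
      unfolding abs_le_iff by (simp add: algebra_simps)
    then show ?thesis using False acc n w(2) by (intro exI[of _ w]) (auto simp: min_def split: if_splits)
  qed
  then obtain p where p: "(onorm (\<lambda>y. (V - gram_outer k p) *v y))\<^sup>2 \<le> \<theta>"
      "norm (e - 2 *\<^sub>R (gram_outer k p *v e)) = norm e"
      "(\<mu> - 2 * b) * (norm e)\<^sup>2 \<le> (e - 2 *\<^sub>R (gram_outer k p *v e)) \<bullet> (H *v e)" by blast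
  let ?W = "V - gram_outer k p" and ?z = "e - 2 *\<^sub>R (gram_outer k p *v e)"
  have "norm (?W *v g) \<le> onorm (\<lambda>y. ?W *v y) * norm g"
    by (intro onorm matrix_vector_mul_bounded_linear)
  also have "\<dots> \<le> sqrt \<theta> * (M * norm e)"
    using real_le_rsqrt[OF p(1)] grad_bound[OF xs, of x] p(1)
    by (intro mult_mono) (auto intro: order_trans[OF zero_le_power2])
  finally have W: "norm (?W *v g) \<le> sqrt \<theta> * (M * norm e)" .
  have "\<bar>e \<bullet> (?W *v g)\<bar> \<le> norm e * norm (?W *v g)" by (rule Cauchy_Schwarz_ineq2)
  also have "\<dots> \<le> norm e * (sqrt \<theta> * (M * norm e))" by (intro mult_left_mono W) simp
  also have "\<dots> = M * sqrt \<theta> * (norm e)\<^sup>2" by (simp add: power2_eq_square)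
  finally have 1: "e \<bullet> (?W *v g) \<le> M * sqrt \<theta> * (norm e)\<^sup>2" by simp
  \<comment> \<open>\<open>grad_hess\<close> produces \<open>e \<bullet> (H *v ?z)\<close>; symmetry
    of the Hessian moves the reflection to the left factor.\<close>
  have 2: "?z \<bullet> g \<ge> ?z \<bullet> (H *v e) - M * norm e / 2 * (norm e)\<^sup>2"
    using grad_hess[OF xs, where x=x and z="?z"] p(2) H.symmetric[of e ?z] by (simp add: power2_eq_square mult_ac)
  have "e \<bullet> ((mat 1 - 2 *\<^sub>R V) *v g) = ?z \<bullet> g - 2 * (e \<bullet> (?W *v g))"
    by (simp add: matrix_vector_mult_diff_rdistrib inner_diff_left inner_diff_right
        gram_outer_symmetric flip: scaleR_matrix_vector_assoc)
  with 1 2 p(3) show ?thesis by (simp add: algebra_simps)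
qed

section \<open>The Hessian of the smoothed function\<close>

context bounded_third_order
begin

lemma dderiv_measurable [measurable]: "length us \<le> 3 \<Longrightarrow> dderiv f us \<in> borel_measurable borel"
  by (intro borel_measurable_continuous_onI dderiv_continuous)

text \<open>Second derivatives are bounded, first derivatives grow at most linearly and
  \<open>f\<close> at most quadratically. One polynomial in \<open>norm r\<close> dominates all
  three cases, with \<open>C\<close> gathering their coefficients.\<close>

lemma integrable_dderiv_shift:
  assumes "length us \<le> 2"
  shows "integrable std_gaussian (\<lambda>r. dderiv f us (x + l *\<^sub>R r))"
proof -
  interpret G: prob_space "std_gaussian :: (real^'n) measure" by (rule prob_space_std_gaussian)
  define C where "C = \<bar>dderiv f us x\<bar> + norm (grad f x) * \<bar>l\<bar> + M * (\<bar>l\<bar> + l\<^sup>2 + 1) * prod_list (map norm us)"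
  have nn: "0 \<le> prod_list (map norm us)" by (induction us) auto
  have le: "\<bar>dderiv f us (x + l *\<^sub>R r)\<bar> \<le> C * (1 + norm r + (norm r)\<^sup>2)" for r
  proof -
    let ?n = "norm r" and ?p = "prod_list (map norm us)"
    have "\<bar>dderiv f us (x + l *\<^sub>R r)\<bar>
      \<le> \<bar>dderiv f us x\<bar> + norm (grad f x) * \<bar>l\<bar> * ?n + M * (\<bar>l\<bar> * ?n + l\<^sup>2 * ?n\<^sup>2 + 1) * ?p"
    proof (cases "length us = 2")
      case True
      then have "\<bar>dderiv f us (x + l *\<^sub>R r)\<bar> \<le> M * 1 * ?p" using dderiv_bound[of us] by simp
      also have "\<dots> \<le> M * (\<bar>l\<bar> * ?n + l\<^sup>2 * ?n\<^sup>2 + 1) * ?p"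
        using M_pos nn by (intro mult_right_mono mult_left_mono) auto
      finally show ?thesis by (smt (verit) abs_ge_zero mult_nonneg_nonneg norm_ge_zero)
    next
      case False
      show ?thesis
      proof (cases us)
        case Nil
        have "\<bar>dderiv f us (x + l *\<^sub>R r) - (dderiv f us x + dderiv f [l *\<^sub>R r] x)\<bar> \<le> M * (\<bar>l\<bar> * ?n)\<^sup>2 / 2"
          using dderiv_taylor[of 2 "[]" x "l *\<^sub>R r"] Nil by (simp add: numeral_2_eq_2 del: dderiv.simps)
        moreover have "M * (\<bar>l\<bar> * ?n)\<^sup>2 / 2 = M * (l\<^sup>2 * ?n\<^sup>2) / 2" by (simp add: power_mult_distrib)
        moreover have "\<bar>dderiv f [l *\<^sub>R r] x\<bar> \<le> norm (grad f x) * \<bar>l\<bar> * ?n"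
          unfolding inner_grad[symmetric] using Cauchy_Schwarz_ineq2[of "grad f x" "l *\<^sub>R r"] by (simp add: mult.assoc)
        moreover have "0 \<le> M * (\<bar>l\<bar> * ?n)" "0 \<le> M * (l\<^sup>2 * ?n\<^sup>2)" using M_pos by auto
        moreover have "M * (\<bar>l\<bar> * ?n + l\<^sup>2 * ?n\<^sup>2 + 1) * ?p = M * (\<bar>l\<bar> * ?n) + M * (l\<^sup>2 * ?n\<^sup>2) + M"
          using Nil by (simp add: distrib_left)
        ultimately show ?thesis using M_pos unfolding Nil by linarith
      next
        case (Cons u us')
        then have u: "us = [u]" using False assms by (cases us') auto
        have "\<bar>dderiv f us (x + l *\<^sub>R r) - dderiv f us x\<bar> \<le> M * (\<bar>l\<bar> * ?n) * ?p"
          using dderiv_taylor[of 1 us x "l *\<^sub>R r"] u by (simp del: dderiv.simps)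
        moreover have "M * (\<bar>l\<bar> * ?n) * ?p \<le> M * (\<bar>l\<bar> * ?n + l\<^sup>2 * ?n\<^sup>2 + 1) * ?p"
          using M_pos nn by (intro mult_right_mono mult_left_mono) auto
        moreover have "0 \<le> norm (grad f x) * \<bar>l\<bar> * ?n" by simp
        ultimately show ?thesis by linarith
      qed
    qed
    also have "\<dots> \<le> \<bar>dderiv f us x\<bar> * (1 + ?n + ?n\<^sup>2) + norm (grad f x) * \<bar>l\<bar> * (1 + ?n + ?n\<^sup>2)
        + M * ((\<bar>l\<bar> + l\<^sup>2 + 1) * (1 + ?n + ?n\<^sup>2)) * ?p"
    proof (intro add_mono mult_right_mono mult_left_mono)
      have "\<bar>dderiv f us x\<bar> * 1 \<le> \<bar>dderiv f us x\<bar> * (1 + ?n + ?n\<^sup>2)"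
        by (intro mult_left_mono) auto
      then show "\<bar>dderiv f us x\<bar> \<le> \<bar>dderiv f us x\<bar> * (1 + ?n + ?n\<^sup>2)" by simp
    qed (use M_pos nn in \<open>auto simp: algebra_simps\<close>)
    also have "\<dots> = C * (1 + ?n + ?n\<^sup>2)" unfolding C_def by (simp only: distrib_left distrib_right mult_ac)
    finally show ?thesis .
  qed
  have "integrable std_gaussian (\<lambda>r::real^'n. C * (1 + norm r + (norm r)\<^sup>2))"
    using integrable_gaussian_norm_power[of 1] integrable_gaussian_norm_power[of 2] by auto
  then show ?thesis
  proof (rule Bochner_Integration.integrable_bound)
    show "(\<lambda>r. dderiv f us (x + l *\<^sub>R r)) \<in> borel_measurable std_gaussian" using assms by simp
    show "AE r in std_gaussian. norm (dderiv f us (x + l *\<^sub>R r)) \<le> norm (C * (1 + norm r + (norm r)\<^sup>2))"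
      using le by (intro AE_I2) (simp add: order_trans[OF _ abs_ge_self])
  qed
qed

text \<open>The Taylor remainder is bounded uniformly in the base point
  \<open>x + l *\<^sub>R r\<close>, so the quadratic bound survives the Gaussian average and gives
  the derivative of the average.\<close>

lemma has_derivative_smoothed:
  assumes "length us \<le> 1"
  shows "(smoothed (dderiv f us) l has_derivative (\<lambda>u. smoothed (dderiv f (u # us)) l x)) (at x)"
\<comment> \<open>The radius 1 is arbitrary: the remainder estimate holds for every
  \<open>y\<close>.\<close>
proof (rule has_derivativeI_sandwich[of 1])
  interpret G: prob_space "std_gaussian :: (real^'n) measure" by (rule prob_space_std_gaussian)
  let ?p = "prod_list (map norm us)"
  have int: "integrable std_gaussian (\<lambda>r. dderiv f us (y + l *\<^sub>R r))"
    "integrable std_gaussian (\<lambda>r. dderiv f (u # us) (y + l *\<^sub>R r))" for y u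
    using assms by (auto intro!: integrable_dderiv_shift simp del: dderiv.simps)
  have lin: "dderiv f ((u + v) # us) y = dderiv f (u # us) y + dderiv f (v # us) y"
    "dderiv f ((c *\<^sub>R u) # us) y = c * dderiv f (u # us) y" for u v y c
    using linear_add[OF dderiv_linear[of us y], of u v] linear_scale[OF dderiv_linear[of us y], of c u] assms
    by (auto simp del: dderiv.simps)
  show "bounded_linear (\<lambda>u. smoothed (dderiv f (u # us)) l x)"
    unfolding linear_conv_bounded_linear[symmetric] smoothed_def
    by (rule linearI) (simp_all add: lin int del: dderiv.simps)
  show "((\<lambda>y. M * ?p / 2 * norm (y - x)) \<longlongrightarrow> 0) (at x)"
    by (auto intro!: tendsto_eq_intros)
  fix y assume y: "y \<noteq> x"
  let ?h = "\<lambda>r. dderiv f us (y + l *\<^sub>R r) - dderiv f us (x + l *\<^sub>R r) - dderiv f ((y - x) # us) (x + l *\<^sub>R r)"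
  let ?B = "M * (norm (y - x))\<^sup>2 * ?p / 2"
  have h: "\<bar>?h r\<bar> \<le> ?B" for r
  proof -
    have "x + l *\<^sub>R r + (y - x) = y + l *\<^sub>R r" by simp
    then show ?thesis
      using dderiv_taylor[of 2 us "x + l *\<^sub>R r" "y - x"] assms
      by (simp only:) (simp add: numeral_2_eq_2 diff_diff_eq del: dderiv.simps)
  qed
  have inth: "integrable std_gaussian ?h" by (intro Bochner_Integration.integrable_diff int)
  have "smoothed (dderiv f us) l y - smoothed (dderiv f us) l x - smoothed (dderiv f ((y - x) # us)) l x
      = integral\<^sup>L std_gaussian ?h"
    unfolding smoothed_def by (simp add: int del: dderiv.simps)
  also have "norm \<dots> \<le> ?B"
  proof -
    have "?h r \<le> ?B" "- ?B \<le> ?h r" for r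
      using abs_le_D1[OF h[of r]] abs_le_D2[OF h[of r]] by linarith+
    then have "integral\<^sup>L std_gaussian ?h \<le> ?B" "- ?B \<le> integral\<^sup>L std_gaussian ?h"
      using G.integral_le_const[OF inth AE_I2] G.integral_ge_const[OF inth AE_I2] by blast+
    then show ?thesis unfolding real_norm_def by linarith
  qed
  finally have "norm (smoothed (dderiv f us) l y - smoothed (dderiv f us) l x - smoothed (dderiv f ((y - x) # us)) l x)
      / norm (y - x) \<le> ?B / norm (y - x)"
    by (rule divide_right_mono) simp
  also have "\<dots> = M * ?p / 2 * norm (y - x)" using y by (simp add: power2_eq_square)
  finally show "norm (smoothed (dderiv f us) l y - smoothed (dderiv f us) l x - smoothed (dderiv f ((y - x) # us)) l x)
      / norm (y - x) \<le> M * ?p / 2 * norm (y - x)" .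
qed simp

lemma dderiv_smoothed:
  "length us \<le> 2 \<Longrightarrow> dderiv (smoothed f l) us = smoothed (dderiv f us) l"
proof (induction us)
  case Nil
  have "dderiv f [] = f" "dderiv (smoothed f l) [] = smoothed f l" by auto
  then show ?case by simp
next
  case (Cons u us)
  then have "dderiv (smoothed f l) us = smoothed (dderiv f us) l" by simp
  then have "dderiv (smoothed f l) (u # us) x = frechet_derivative (smoothed (dderiv f us) l) (at x) u" for x
    by simp
  moreover have "frechet_derivative (smoothed (dderiv f us) l) (at x) = (\<lambda>u. smoothed (dderiv f (u # us)) l x)" for x
    using Cons.prems has_derivative_smoothed[of us l x] by (intro frechet_derivative_at[symmetric]) simp
  ultimately show ?case by (intro ext) (simp del: dderiv.simps)
qed

lemma hess_smoothed_bilinear: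
  "y \<bullet> (hess (smoothed f l) x *v z) = smoothed (dderiv f [y, z]) l x"
proof -
  have int: "integrable std_gaussian (\<lambda>r. dderiv f [u, v] (x + l *\<^sub>R r))" for u v
    by (intro integrable_dderiv_shift) simp
  have expand: "y \<bullet> (A *v z) = (\<Sum>i\<in>UNIV. \<Sum>j\<in>UNIV. y $ i * z $ j * A $ i $ j)" for A :: "real^'n^'n"
    by (simp add: inner_vec_def matrix_vector_mult_def sum_distrib_left mult_ac)
  have "y \<bullet> (hess (smoothed f l) x *v z) =
      (\<Sum>i\<in>UNIV. \<Sum>j\<in>UNIV. y $ i * z $ j * smoothed (dderiv f [axis i 1, axis j 1]) l x)"
    unfolding expand hess_def by (simp add: dderiv_smoothed del: dderiv.simps)
  also have "\<dots> = (\<integral>r. (\<Sum>i\<in>UNIV. \<Sum>j\<in>UNIV. y $ i * z $ j * dderiv f [axis i 1, axis j 1] (x + l *\<^sub>R r)) \<partial>std_gaussian)"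
    unfolding smoothed_def by (simp add: int del: dderiv.simps)
  also have "\<dots> = smoothed (dderiv f [y, z]) l x"
    unfolding smoothed_def dderiv_hess[of y z] expand by (simp add: hess_def del: dderiv.simps)
  finally show ?thesis .
qed

text \<open>The third-derivative bound makes the Hessian Lipschitz with constant \<open>M\<close>,
  and the mean length of the shift is at most \<open>l\<close> times the root of the dimension.
  First order in \<open>l\<close> is enough, because \<open>gap_bounds\<close> compares it with
  \<open>\<surd>\<theta>\<close>.\<close>

lemma hess_smoothed_close:
  assumes "0 < l"
  shows "\<bar>y \<bullet> (hess (smoothed f l) x *v z) - y \<bullet> (hess f x *v z)\<bar> \<le> M * l * sqrt (real CARD('n)) * norm y * norm z"
proof -
  interpret G: prob_space "std_gaussian :: (real^'n) measure" by (rule prob_space_std_gaussian)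
  let ?D = "dderiv f [y, z]"
  have int: "integrable std_gaussian (\<lambda>r. ?D (x + l *\<^sub>R r))"
    by (intro integrable_dderiv_shift) simp
  have le: "\<bar>?D (x + l *\<^sub>R r) - ?D x\<bar> \<le> M * l * norm y * norm z * norm r" for r
    using dderiv_taylor[of 1 "[y, z]" x "l *\<^sub>R r"] assms by (simp add: mult_ac del: dderiv.simps)
  have "\<bar>y \<bullet> (hess (smoothed f l) x *v z) - y \<bullet> (hess f x *v z)\<bar> = \<bar>\<integral>r. (?D (x + l *\<^sub>R r) - ?D x) \<partial>std_gaussian\<bar>"
    unfolding hess_smoothed_bilinear dderiv_hess[symmetric]
    by (simp add: smoothed_def int G.prob_space[simplified] del: dderiv.simps)
  also have "\<dots> \<le> (\<integral>r. \<bar>?D (x + l *\<^sub>R r) - ?D x\<bar> \<partial>std_gaussian)"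
    by (rule integral_abs_bound)
  also have "\<dots> \<le> (\<integral>r. M * l * norm y * norm z * norm (r::real^'n) \<partial>std_gaussian)"
    using integrable_gaussian_norm_power[of 1]
    by (intro integral_mono integrable_abs Bochner_Integration.integrable_diff int le
        integrable_mult_right) (auto)
  also have "\<dots> = M * l * norm y * norm z * (integral\<^sup>L std_gaussian (\<lambda>r::real^'n. norm r))" by simp
  also have "\<dots> \<le> M * l * norm y * norm z * sqrt (real CARD('n))"
    using M_pos assms by (intro mult_left_mono gaussian_norm_le) auto
  finally show ?thesis by (simp add: mult_ac)
qed

end

section \<open>Measurability and independence along a run\<close>

text \<open>The correction is projected orthogonally to \<open>v\<close> and to all
  \<open>w q\<close>. Hence \<open>z \<bullet> v = 1\<close>, which keeps \<open>z\<close> away from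
  zero and makes the normalisation legitimate for any step size.\<close>

lemma inner_step_unit_orthogonal:
  assumes v: "v \<bullet> v = 1" "\<And>q. q \<in> {1..j - 1} \<Longrightarrow> v \<bullet> w q = 0"
    and w: "\<And>p q. p \<in> {1..j - 1} \<Longrightarrow> q \<in> {1..j - 1} \<Longrightarrow> w p \<bullet> w q = (if p = q then 1 else 0)"
  shows "norm (inner_step f j w x a h r v) = 1"
    and "q \<in> {1..j - 1} \<Longrightarrow> inner_step f j w x a h r v \<bullet> w q = 0"
proof -
  define g where "g = H_est f v x r h"
  define z where "z = v - a *\<^sub>R (g - (g \<bullet> v) *\<^sub>R v - (\<Sum>q = 1..j - 1. (g \<bullet> w q) *\<^sub>R w q))"
  have step: "inner_step f j w x a h r v = z /\<^sub>R norm z"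
    unfolding inner_step_def z_def g_def Let_def
    by (simp add: matrix_vector_mult_diff_rdistrib gram_outer_mult)
  have "(\<Sum>q = 1..j - 1. (g \<bullet> w q) *\<^sub>R w q) \<bullet> v = 0"
    unfolding inner_sum_left using v(2) by (intro sum.neutral) (simp add: inner_commute)
  then have "z \<bullet> v = 1"
    unfolding z_def using v(1) by (simp add: inner_diff_left)
  then have "z \<noteq> 0" by auto
  then show "norm (inner_step f j w x a h r v) = 1" unfolding step by simp
  show "inner_step f j w x a h r v \<bullet> w q = 0" if q: "q \<in> {1..j - 1}"
  proof -
    have "(\<Sum>p = 1..j - 1. (g \<bullet> w p) *\<^sub>R w p) \<bullet> w q = (\<Sum>p = 1..j - 1. if p = q then g \<bullet> w q else 0)"
      unfolding inner_sum_left by (intro sum.cong) (use w q in auto)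
    then have "z \<bullet> w q = 0" unfolding z_def using v(2)[OF q] q by (simp add: inner_diff_left)
    then show ?thesis unfolding step by simp
  qed
qed

lemma measurable_F_est:
  assumes [measurable]: "f \<in> borel_measurable borel" "x \<in> borel_measurable N" "r \<in> borel_measurable N"
  shows "(\<lambda>\<omega>. F_est f (x \<omega>) (r \<omega>) h) \<in> borel_measurable N"
  unfolding F_est_def by measurable

lemma measurable_gram_outer:
  assumes "\<And>q. q \<in> {1..k} \<Longrightarrow> w q \<in> borel_measurable N" "y \<in> borel_measurable N"
  shows "(\<lambda>\<omega>. gram_outer k (\<lambda>q. w q \<omega>) *v y \<omega>) \<in> borel_measurable N"
  unfolding gram_outer_mult using assms
  by (intro borel_measurable_sum borel_measurable_scaleR borel_measurable_inner) auto

lemma measurable_inner_step: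
  assumes [measurable]: "f \<in> borel_measurable borel" "x \<in> borel_measurable N" "r \<in> borel_measurable N" "v \<in> borel_measurable N"
    and w: "\<And>q. q \<in> {1..j - 1} \<Longrightarrow> w q \<in> borel_measurable N"
  shows "(\<lambda>\<omega>. inner_step f j (\<lambda>q. w q \<omega>) (x \<omega>) a h (r \<omega>) (v \<omega>)) \<in> borel_measurable N"
proof -
  let ?H = "\<lambda>\<omega>. H_est f (v \<omega>) (x \<omega>) (r \<omega>) h"
  have [measurable]: "?H \<in> borel_measurable N"
    unfolding H_est_def by (intro borel_measurable_scaleR borel_measurable_diff measurable_F_est) measurable
  have [measurable]: "(\<lambda>\<omega>. gram_outer (j - 1) (\<lambda>q. w q \<omega>) *v ?H \<omega>) \<in> borel_measurable N"
    by (rule measurable_gram_outer[OF w]) measurable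
  have [measurable]: "(\<lambda>\<omega>. gram_outer 1 (\<lambda>_. v \<omega>) *v ?H \<omega>) \<in> borel_measurable N"
    by (rule measurable_gram_outer) measurable
  show ?thesis unfolding inner_step_def Let_def matrix_vector_mult_diff_rdistrib matrix_vector_mul_lid
    by measurable
qed

context saddle_search_run
begin

abbreviation eigvec :: "nat \<Rightarrow> nat \<Rightarrow> 'w \<Rightarrow> real^'n" where
  "eigvec n j \<omega> \<equiv> v n j (N n j \<omega>) \<omega>"

text \<open>Strong induction over \<open>j\<close> makes the earlier outputs orthonormal, which the
  inner induction over steps needs for \<open>inner_step_unit_orthogonal\<close>.\<close>

lemma inner_iterate_unit_orthogonal:
  assumes "\<omega> \<in> space P" "j \<in> {1..k}"
  shows "norm (v n j i \<omega>) = 1 \<and> (\<forall>q\<in>{1..<j}. v n j i \<omega> \<bullet> eigvec n q \<omega> = 0)"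
  using assms(2)
proof (induction j arbitrary: i rule: less_induct)
  case (less j)
  have IH: "norm (eigvec n q \<omega>) = 1" "\<forall>p\<in>{1..<q}. eigvec n q \<omega> \<bullet> eigvec n p \<omega> = 0"
    if "q \<in> {1..j - 1}" for q
    using less.IH[of q] less.prems that by auto
  have w: "eigvec n p \<omega> \<bullet> eigvec n q \<omega> = (if p = q then 1 else 0)"
    if "p \<in> {1..j - 1}" "q \<in> {1..j - 1}" for p q
    using IH[of p] IH[of q] that
    by (cases p q rule: linorder_cases) (auto simp: norm_eq_1 inner_commute)
  show ?case
  proof (induction i)
    case 0
    then show ?case using start_unit[of j \<omega> n] start_orth[of j _ \<omega> n] less.prems assms(1) by auto
  next
    case (Suc i)
    have v: "v n j i \<omega> \<bullet> v n j i \<omega> = 1" "\<And>q. q \<in> {1..j - 1} \<Longrightarrow> v n j i \<omega> \<bullet> eigvec n q \<omega> = 0"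
      using Suc.IH less.prems by (auto simp: norm_eq_1)
    show ?case
      unfolding v_Suc[OF less.prems assms(1)]
      using inner_step_unit_orthogonal[OF v w] by auto
  qed
qed

lemma eigvec_orthonormal:
  assumes "\<omega> \<in> space P" "i \<in> {1..k}" "j \<in> {1..k}"
  shows "eigvec n i \<omega> \<bullet> eigvec n j \<omega> = (if i = j then 1 else 0)"
  using inner_iterate_unit_orthogonal[OF assms(1,2), of n "N n i \<omega>"]
    inner_iterate_unit_orthogonal[OF assms(1,3), of n "N n j \<omega>"] assms(2,3)
  by (cases i j rule: linorder_cases) (auto simp: norm_eq_1 inner_commute)

lemma \<F>_mono: "j \<in> {1..k} \<Longrightarrow> i \<le> i' \<Longrightarrow> sets (\<F> n j i) \<subseteq> sets (\<F> n j i')"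
  by (rule lift_Suc_mono_le[of "\<lambda>i. sets (\<F> n j i)"]) (use \<F>_step in auto)

text \<open>Every step of an earlier search, even one past its stopping index, precedes the first
  step of a later search. Thus an output taken at a random index is known to all later
  searches.\<close>

lemma \<F>_le_later:
  assumes "1 \<le> j" "j < j'" "j' \<le> k"
  shows "sets (\<F> n j i) \<subseteq> sets (\<F> n j' i')"
  using assms(2,3)
proof (induction j' arbitrary: i' rule: less_induct)
  case (less j')
  have 1: "sets (\<F> n j' 0) \<subseteq> sets (\<F> n j' i')" using less.prems assms(1) by (intro \<F>_mono) auto
  have "j' - 1 \<in> {1..<k}" "Suc (j' - 1) = j'" using less.prems assms(1) by auto
  then have 2: "sets (\<F> n (j' - 1) i'') \<subseteq> sets (\<F> n j' 0)" for i''
    using \<F>_next[of "j' - 1" n i''] by metis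
  show ?case
  proof (cases "j = j' - 1")
    case True
    then show ?thesis using 1 2 by auto
  next
    case False
    then have "sets (\<F> n j i) \<subseteq> sets (\<F> n (j' - 1) 0)" using less by (intro less.IH) auto
    then show ?thesis using 1 2 by blast
  qed
qed

lemma \<F>_le_\<G>:
  assumes "j \<in> {1..k}"
  shows "sets (\<F> n j i) \<subseteq> sets (\<G> n)"
proof (cases "j = k")
  case False
  then have "sets (\<F> n j i) \<subseteq> sets (\<F> n k 0)" using assms by (intro \<F>_le_later) auto
  then show ?thesis using \<F>_\<G>[of n 0] by blast
qed (use \<F>_\<G> in auto)

lemma space_\<F>: "j \<in> {1..k} \<Longrightarrow> space (\<F> n j i) = space P"
  using sub_\<F> by (auto simp: subalgebra_def)

lemma space_\<G>: "space (\<G> n) = space P"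
  using sub_\<G> by (auto simp: subalgebra_def)

lemma measurable_enlarge:
  "g \<in> measurable M' K \<Longrightarrow> space M' = space M'' \<Longrightarrow> sets M' \<subseteq> sets M'' \<Longrightarrow> g \<in> measurable M'' K"
  by (rule measurable_from_subalg[of M'' M']) (auto simp: subalgebra_def)

text \<open>The output is read off at the random index \<open>N n j\<close>, so measurability is
  checked on the countably many values of this index. \<open>K\<close> contains the information of
  all steps, which makes the stopping time measurable for it as well.\<close>

lemma measurable_eigvec_enlarge:
  assumes j: "j \<in> {1..k}" and v: "\<And>i. v n j i \<in> borel_measurable (\<F> n j i)"
    and K: "space K = space P" "\<And>i. sets (\<F> n j i) \<subseteq> sets K"
  shows "eigvec n j \<in> borel_measurable K"
proof (rule measurable_compose_countable)
  have "N n j \<in> borel_measurable K"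
    by (rule measurable_stopping_time[OF N_stopping[OF j]]) (use K in \<open>auto simp: space_\<F>[OF j]\<close>)
  then show "N n j \<in> measurable K (count_space UNIV)"
    by (simp add: measurable_cong_sets[OF refl sets_borel_eq_count_space])
  show "v n j i \<in> borel_measurable K" for i
    by (rule measurable_enlarge[OF v]) (use K j in \<open>auto simp: space_\<F>\<close>)
qed

text \<open>Two nested inductions: the one over \<open>j\<close> supplies the outputs of the earlier
  searches, the one over \<open>i\<close> follows the current search. Measurability of
  \<open>X n\<close> is a premise here and is discharged by induction over \<open>n\<close> in
  \<open>measurable_iterate\<close>.\<close>

lemma measurable_inner_iterate:
  assumes f: "f \<in> borel_measurable borel" and X: "X n \<in> borel_measurable (\<F> n 1 0)"
    and "j \<in> {1..k}"
  shows "v n j i \<in> borel_measurable (\<F> n j i)"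
  using assms(3)
proof (induction j arbitrary: i rule: less_induct)
  case (less j)
  have w: "eigvec n q \<in> borel_measurable (\<F> n j i)" if "q \<in> {1..j - 1}" for q i
    using that less by (intro measurable_eigvec_enlarge \<F>_le_later) (auto simp: space_\<F>)
  have X': "X n \<in> borel_measurable (\<F> n j i)" for i
  proof (rule measurable_enlarge[OF X])
    show "sets (\<F> n 1 0) \<subseteq> sets (\<F> n j i)"
      using less.prems \<F>_mono[of 1 0 i n] \<F>_le_later[of 1 j n 0 i] by (cases "j = 1") auto
  qed (use less.prems in \<open>auto simp: space_\<F>\<close>)
  show ?case
  proof (induction i)
    case 0
    show ?case using start_meas less.prems by blast
  next
    case (Suc i)
    have "v n j i \<in> borel_measurable (\<F> n j (Suc i))"
      by (rule measurable_enlarge[OF Suc.IH]) (use less.prems \<F>_step in \<open>auto simp: space_\<F>\<close>)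
    then have "(\<lambda>\<omega>. inner_step f j (\<lambda>q. eigvec n q \<omega>) (X n \<omega>) (\<alpha>v i) (lv n i) (s n j i \<omega>) (v n j i \<omega>))
        \<in> borel_measurable (\<F> n j (Suc i))"
      using f X' w s_meas[OF less.prems] by (intro measurable_inner_step) auto
    then show ?case
      using v_Suc[OF less.prems] by (subst measurable_cong) (auto simp: space_\<F>[OF less.prems])
  qed
qed

lemma measurable_iterate:
  assumes f: "f \<in> borel_measurable borel" and k: "1 \<le> k"
  shows "X n \<in> borel_measurable (\<F> n 1 0)"
proof (induction n)
  case 0
  show ?case by (rule X0_meas)
next
  case (Suc n)
  let ?K = "\<F> (Suc n) 1 0"
  have K: "space ?K = space P" using k by (auto simp: space_\<F>)
  have sub: "sets (\<F> n j i) \<subseteq> sets ?K" if "j \<in> {1..k}" for i j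
    using \<F>_le_\<G>[OF that, of n i] \<G>_\<F>[of n] by blast
  have w: "eigvec n j \<in> borel_measurable ?K" if "j \<in> {1..k}" for j
    using that measurable_inner_iterate[OF f Suc.IH] K sub by (intro measurable_eigvec_enlarge) auto
  have [measurable]: "X n \<in> borel_measurable ?K"
    by (rule measurable_enlarge[OF Suc.IH]) (use k sub in \<open>auto simp: space_\<F>\<close>)
  have [measurable]: "(\<lambda>\<omega>. F_est f (X n \<omega>) (r n \<omega>) l) \<in> borel_measurable ?K"
    using r_meas by (intro measurable_F_est f) measurable
  have [measurable]: "(\<lambda>\<omega>. gram_outer k (\<lambda>j. eigvec n j \<omega>) *v F_est f (X n \<omega>) (r n \<omega>) l) \<in> borel_measurable ?K"
    by (rule measurable_gram_outer[OF w]) measurable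
  have "(\<lambda>\<omega>. X n \<omega> - \<alpha> *\<^sub>R (F_est f (X n \<omega>) (r n \<omega>) l
      - 2 *\<^sub>R (gram_outer k (\<lambda>j. eigvec n j \<omega>) *v F_est f (X n \<omega>) (r n \<omega>) l))) \<in> borel_measurable ?K"
    by measurable
  then show ?case
    using X_Suc K
    by (subst measurable_cong)
      (auto simp: matrix_vector_mult_diff_rdistrib simp flip: scaleR_matrix_vector_assoc)
qed

lemma measurable_iterate_\<G>:
  assumes "f \<in> borel_measurable borel" "1 \<le> k" "m \<le> n"
  shows "X m \<in> borel_measurable (\<G> n)"
proof -
  have "sets (\<G> m) \<subseteq> sets (\<G> n)"
  proof (rule lift_Suc_mono_le[of "\<lambda>n. sets (\<G> n)"])
    show "sets (\<G> i) \<subseteq> sets (\<G> (Suc i))" for i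
      using \<G>_\<F>[of i] \<F>_le_\<G>[of 1 "Suc i" 0] assms(2) by auto
  qed fact
  then show ?thesis
    using assms(2) \<F>_le_\<G>[of 1 m 0]
    by (intro measurable_enlarge[OF measurable_iterate[OF assms(1,2)]])
      (auto simp: space_\<F> space_\<G>)
qed

lemma measurable_eigvec_\<G>:
  assumes "f \<in> borel_measurable borel" "1 \<le> k" "j \<in> {1..k}"
  shows "eigvec n j \<in> borel_measurable (\<G> n)"
  using assms measurable_inner_iterate[OF assms(1) measurable_iterate]
  by (intro measurable_eigvec_enlarge \<F>_le_\<G>) (auto simp: space_\<G>)

lemma random_variable_sample: "1 \<le> k \<Longrightarrow> r n \<in> borel_measurable P"
  using measurable_from_subalg[OF sub_\<F> r_meas] by simp

section \<open>Expectations against a fresh Gaussian sample\<close>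

text \<open>This product rule takes the place of conditioning on \<open>\<G> n\<close>: a weight
  known before \<open>r n\<close> is drawn is independent of every function of
  \<open>r n\<close>.\<close>

lemma has_bochner_integral_fresh_sample:
  fixes Z :: "'w \<Rightarrow> real" and h :: "real^'n \<Rightarrow> real"
  assumes k: "1 \<le> k" and Z: "Z \<in> borel_measurable (\<G> n)" "integrable P Z"
    and h: "has_bochner_integral std_gaussian h c"
  shows "has_bochner_integral P (\<lambda>\<omega>. Z \<omega> * h (r n \<omega>)) (expectation Z * c)"
proof -
  note [measurable] = random_variable_sample[OF k]
  have hm[measurable]: "h \<in> borel_measurable borel"
    using h by (auto simp: has_bochner_integral_iff cong: measurable_cong_sets)
  have "has_bochner_integral (distr P borel (r n)) h c" using h by (simp add: r_gaussian)
  then have hr: "integrable P (\<lambda>\<omega>. h (r n \<omega>))" "expectation (\<lambda>\<omega>. h (r n \<omega>)) = c"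
    using integrable_distr[of "r n" P borel h] integral_distr[of "r n" P borel h]
    by (auto simp: has_bochner_integral_iff)
  have "indep_var borel Z borel (\<lambda>\<omega>. h (r n \<omega>))"
    unfolding indep_var_eq
  proof (intro conjI)
    show "random_variable borel Z" using Z(2) by auto
    show "random_variable borel (\<lambda>\<omega>. h (r n \<omega>))" by measurable
    let ?A = "sigma_sets (space P) {Z -` A \<inter> space P |A. A \<in> sets borel}"
    let ?B = "sigma_sets (space P) {(\<lambda>\<omega>. h (r n \<omega>)) -` A \<inter> space P |A. A \<in> sets borel}"
    have "?A \<subseteq> sets (\<G> n)"
      unfolding space_\<G>[of n, symmetric]
      by (rule sets.sigma_sets_subset) (use measurable_sets[OF Z(1)] in auto)
    moreover have "?B \<subseteq> sets (vimage_algebra (space P) (r n) borel)"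
    proof -
      have "(\<lambda>\<omega>. h (r n \<omega>)) \<in> borel_measurable (vimage_algebra (space P) (r n) borel)"
        by (rule measurable_compose[OF measurable_vimage_algebra1 hm]) auto
      from measurable_sets[OF this]
      have "{(\<lambda>\<omega>. h (r n \<omega>)) -` A \<inter> space P |A. A \<in> sets borel} \<subseteq> sets (vimage_algebra (space P) (r n) borel)"
        by auto
      then show ?thesis
        using sets.sigma_sets_subset[of _ "vimage_algebra (space P) (r n) borel"] by simp
    qed
    \<comment> \<open>Both generated sigma-algebras are contained in the two that
      \<open>r_fresh\<close> declares independent.\<close>
    ultimately show "indep_set ?A ?B"
      using r_fresh[of n] unfolding indep_sets2_eq by blast
  qed
  from indep_var_lebesgue_integral[OF this Z(2) hr(1)] indep_var_integrable[OF this Z(2) hr(1)] hr(2)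
  show ?thesis by (simp add: has_bochner_integral_iff)
qed

text \<open>Expanding in coordinates separates the known vectors \<open>a\<close> and
  \<open>b\<close> from the sample. The matrix moment of the sample is \<open>c\<close> times the
  identity, so the double sum collapses to an inner product.\<close>

lemma has_bochner_integral_fresh_bilinear:
  fixes a b :: "'w \<Rightarrow> real^'n" and \<phi> :: "real^'n \<Rightarrow> real"
  assumes k: "1 \<le> k" and Z: "\<And>i j. (\<lambda>\<omega>. Z \<omega> * (a \<omega> $ i * b \<omega> $ j)) \<in> borel_measurable (\<G> n)"
      "\<And>i j. integrable P (\<lambda>\<omega>. Z \<omega> * (a \<omega> $ i * b \<omega> $ j))"
    and \<phi>: "\<And>i j. has_bochner_integral std_gaussian (\<lambda>x. \<phi> x * (x $ i * x $ j)) (if i = j then c else 0)"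
  shows "has_bochner_integral P (\<lambda>\<omega>. Z \<omega> * (\<phi> (r n \<omega>) * ((a \<omega> \<bullet> r n \<omega>) * (b \<omega> \<bullet> r n \<omega>))))
    (expectation (\<lambda>\<omega>. Z \<omega> * (a \<omega> \<bullet> b \<omega>)) * c)"
proof -
  have "has_bochner_integral P
     (\<lambda>\<omega>. \<Sum>i\<in>UNIV. \<Sum>j\<in>UNIV. (Z \<omega> * (a \<omega> $ i * b \<omega> $ j)) * (\<phi> (r n \<omega>) * (r n \<omega> $ i * r n \<omega> $ j)))
     (\<Sum>i\<in>UNIV. \<Sum>j\<in>UNIV. expectation (\<lambda>\<omega>. Z \<omega> * (a \<omega> $ i * b \<omega> $ j)) * (if i = j then c else 0))"
    by (intro has_bochner_integral_sum has_bochner_integral_fresh_sample k Z \<phi>)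
  moreover have "(\<Sum>i\<in>UNIV. \<Sum>j\<in>UNIV. (Z \<omega> * (a \<omega> $ i * b \<omega> $ j)) * (\<phi> (r n \<omega>) * (r n \<omega> $ i * r n \<omega> $ j)))
      = Z \<omega> * (\<phi> (r n \<omega>) * ((a \<omega> \<bullet> r n \<omega>) * (b \<omega> \<bullet> r n \<omega>)))" for \<omega>
  proof -
    have "(a \<omega> \<bullet> r n \<omega>) * (b \<omega> \<bullet> r n \<omega>)
        = (\<Sum>i\<in>UNIV. \<Sum>j\<in>UNIV. (a \<omega> $ i * r n \<omega> $ i) * (b \<omega> $ j * r n \<omega> $ j))"
      by (simp only: inner_vec_def sum_product inner_real_def)
    then show ?thesis by (simp add: sum_distrib_left mult_ac)
  qed
  moreover have "(\<Sum>i\<in>UNIV. \<Sum>j\<in>UNIV. expectation (\<lambda>\<omega>. Z \<omega> * (a \<omega> $ i * b \<omega> $ j)) * (if i = j then c else 0))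
      = expectation (\<lambda>\<omega>. Z \<omega> * (a \<omega> \<bullet> b \<omega>)) * c"
    by (simp add: if_distrib inner_vec_def sum_distrib_left Z(2) flip: sum_distrib_right cong: if_cong)
  ultimately show ?thesis by simp
qed

end

section \<open>The mean square recursion\<close>

lemma (in bounded_third_order) grad_measurable: "grad f \<in> borel_measurable borel"
  unfolding grad_def
  by (intro borel_measurable_continuous_onI continuous_on_vec_lambda dderiv_continuous) simp

lemma measurable_vec_nth [measurable (raw)]:
  fixes h :: "'w \<Rightarrow> real^'n"
  assumes [measurable]: "h \<in> borel_measurable K"
  shows "(\<lambda>\<omega>. h \<omega> $ i) \<in> borel_measurable K"
proof -
  have "(\<lambda>\<omega>. h \<omega> \<bullet> axis i 1) \<in> borel_measurable K" by measurable
  then show ?thesis by (simp add: inner_axis)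
qed

context saddle_search_run
begin

text \<open>The reflection is symmetric and isometric: in the cross term it is moved onto
  \<open>e\<close>, giving \<open>a\<close>, and in the squared step length it disappears. Every
  term of the bound is built from vectors known before \<open>r n\<close> and from
  \<open>r n\<close> itself, ready for the product rules above.\<close>

lemma norm_step_le:
  fixes n :: nat and xs :: "real^'n"
  assumes f: "bounded_third_order f M" and \<omega>: "\<omega> \<in> space P"
  defines "e \<equiv> X n \<omega> - xs" and "g \<equiv> grad f (X n \<omega>)" and "B \<equiv> M * l\<^sup>2 / 6"
  defines "a \<equiv> e - 2 *\<^sub>R (gram_outer k (\<lambda>j. eigvec n j \<omega>) *v e)"
  shows "(norm (X (Suc n) \<omega> - xs))\<^sup>2 \<le> (norm e)\<^sup>2 - 2 * \<alpha> * ((a \<bullet> r n \<omega>) * (g \<bullet> r n \<omega>))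
    + 2 * \<alpha> * B * (norm e * norm (r n \<omega>) ^ 4)
    + 2 * \<alpha>\<^sup>2 * ((norm (r n \<omega>))\<^sup>2 * ((g \<bullet> r n \<omega>) * (g \<bullet> r n \<omega>)))
    + 2 * \<alpha>\<^sup>2 * B\<^sup>2 * norm (r n \<omega>) ^ 8"
proof -
  interpret f: bounded_third_order f M by fact
  let ?r = "r n \<omega>" and ?V = "gram_outer k (\<lambda>j. eigvec n j \<omega>)"
  define F q where "F = F_est f (X n \<omega>) ?r l" and "q = F - (g \<bullet> ?r) *\<^sub>R ?r"
  have q: "norm q \<le> B * norm ?r ^ 4"
    unfolding q_def F_def g_def B_def by (rule f.F_est_expansion[OF l_pos])
  have F: "F = (g \<bullet> ?r) *\<^sub>R ?r + q" unfolding q_def by simp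
  have reflect: "norm (y - 2 *\<^sub>R (?V *v y)) = norm y" for y
    by (intro norm_reflection eigvec_orthonormal \<omega>)
  have expand: "(norm (y - \<alpha> *\<^sub>R z))\<^sup>2 = (norm y)\<^sup>2 - 2 * \<alpha> * (y \<bullet> z) + \<alpha>\<^sup>2 * (norm z)\<^sup>2" for y z :: "real^'n"
    unfolding power2_norm_eq_inner
    by (simp add: inner_diff_left inner_diff_right inner_commute[of z y] power2_eq_square right_diff_distrib)
  have "X (Suc n) \<omega> - xs = e - \<alpha> *\<^sub>R (F - 2 *\<^sub>R (?V *v F))"
    unfolding X_Suc[OF \<omega>] e_def F_def
    by (simp add: matrix_vector_mult_diff_rdistrib flip: scaleR_matrix_vector_assoc)
  then have "(norm (X (Suc n) \<omega> - xs))\<^sup>2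
      = (norm e)\<^sup>2 - 2 * \<alpha> * (e \<bullet> (F - 2 *\<^sub>R (?V *v F))) + \<alpha>\<^sup>2 * (norm (F - 2 *\<^sub>R (?V *v F)))\<^sup>2"
    using expand[of e "F - 2 *\<^sub>R (?V *v F)"] by simp
  also have "e \<bullet> (F - 2 *\<^sub>R (?V *v F)) = a \<bullet> F"
    unfolding a_def by (simp add: inner_diff_left inner_diff_right gram_outer_symmetric)
  also have "norm (F - 2 *\<^sub>R (?V *v F)) = norm F" by (rule reflect)
  finally have eq: "(norm (X (Suc n) \<omega> - xs))\<^sup>2 = (norm e)\<^sup>2 - 2 * \<alpha> * (a \<bullet> F) + \<alpha>\<^sup>2 * (norm F)\<^sup>2" .
  have "- (a \<bullet> q) \<le> norm a * norm q" using Cauchy_Schwarz_ineq2[of a q] by linarith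
  also have "\<dots> \<le> norm e * (B * norm ?r ^ 4)"
    unfolding a_def reflect by (intro mult_left_mono q) simp
  finally have "(a \<bullet> ?r) * (g \<bullet> ?r) - B * (norm e * norm ?r ^ 4) \<le> a \<bullet> F"
    unfolding F by (simp add: inner_add_right mult_ac)
  from mult_left_mono[OF this, of "2 * \<alpha>"] \<alpha>_pos
  have 1: "- 2 * \<alpha> * (a \<bullet> F) \<le> - 2 * \<alpha> * ((a \<bullet> ?r) * (g \<bullet> ?r)) + 2 * \<alpha> * B * (norm e * norm ?r ^ 4)"
    by (simp add: algebra_simps)
  have "norm F \<le> norm ((g \<bullet> ?r) *\<^sub>R ?r) + norm q" unfolding F by (rule norm_triangle_ineq)
  then have "(norm F)\<^sup>2 \<le> (norm ((g \<bullet> ?r) *\<^sub>R ?r) + norm q)\<^sup>2" by (intro power_mono) auto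
  \<comment> \<open>This factor 2 times the moment \<open>d + 2\<close> yields the
    \<open>2 d + 4\<close> of the step size condition.\<close>
  also have "\<dots> \<le> 2 * (norm ((g \<bullet> ?r) *\<^sub>R ?r))\<^sup>2 + 2 * (norm q)\<^sup>2"
    using zero_le_power2[of "norm ((g \<bullet> ?r) *\<^sub>R ?r) - norm q"] by (simp add: power2_eq_square algebra_simps)
  also have "(norm q)\<^sup>2 \<le> (B * norm ?r ^ 4)\<^sup>2" by (intro power_mono q) simp
  finally have "(norm F)\<^sup>2 \<le> 2 * ((norm ?r)\<^sup>2 * ((g \<bullet> ?r) * (g \<bullet> ?r))) + 2 * (B\<^sup>2 * norm ?r ^ 8)"
    by (simp add: power_mult_distrib power2_eq_square[of "g \<bullet> ?r"] mult_ac flip: power_mult)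
  from mult_left_mono[OF this, of "\<alpha>\<^sup>2"]
  have 2: "\<alpha>\<^sup>2 * (norm F)\<^sup>2 \<le> 2 * \<alpha>\<^sup>2 * ((norm ?r)\<^sup>2 * ((g \<bullet> ?r) * (g \<bullet> ?r))) + 2 * \<alpha>\<^sup>2 * B\<^sup>2 * norm ?r ^ 8"
    by (simp add: algebra_simps)
  from 1 2 eq show ?thesis by linarith
qed

text \<open>Restricting to \<open>A\<close> bounds the error by \<open>\<rho>\<close>, which makes
  all weights integrable; since \<open>A\<close> lies in \<open>\<G> n\<close>, its indicator is
  itself a weight known before \<open>r n\<close>. The parameter \<open>\<eta>\<close> balances the
  discretisation error against the contraction.\<close>

lemma mean_square_step:
  fixes n :: nat and xs :: "real^'n"
  assumes f: "bounded_third_order f M" and k: "1 \<le> k" and xs: "grad f xs = 0"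
    and A: "A \<in> sets (\<G> n)" and \<rho>: "\<And>\<omega>. \<omega> \<in> A \<Longrightarrow> norm (X n \<omega> - xs) \<le> \<rho>"
    and c: "AE \<omega> in P. \<omega> \<in> A \<longrightarrow> c * (norm (X n \<omega> - xs))\<^sup>2
      \<le> (X n \<omega> - xs) \<bullet> ((mat 1 - 2 *\<^sub>R gram_outer k (\<lambda>j. eigvec n j \<omega>)) *v grad f (X n \<omega>))"
    and \<eta>: "0 < \<eta>"
  defines "m4 \<equiv> integral\<^sup>L std_gaussian (\<lambda>x::real^'n. norm x ^ 4)"
    and "m8 \<equiv> integral\<^sup>L std_gaussian (\<lambda>x::real^'n. norm x ^ 8)"
  shows "integrable P (\<lambda>\<omega>. indicator A \<omega> * (norm (X (Suc n) \<omega> - xs))\<^sup>2)"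
    and "expectation (\<lambda>\<omega>. indicator A \<omega> * (norm (X (Suc n) \<omega> - xs))\<^sup>2)
      \<le> (1 - 2 * \<alpha> * c + \<alpha> * \<eta> + \<alpha>\<^sup>2 * ((2 * real CARD('n) + 4) * M\<^sup>2))
          * expectation (\<lambda>\<omega>. indicator A \<omega> * (norm (X n \<omega> - xs))\<^sup>2)
        + (\<alpha> * ((M / 6 * m4)\<^sup>2 / \<eta>) + 2 * \<alpha>\<^sup>2 * ((M / 6)\<^sup>2 * m8)) * l ^ 4"
proof -
  interpret f: bounded_third_order f M by fact
  define d where "d = real CARD('n)"
  define B where "B = M * l\<^sup>2 / 6"
  define Z :: "'w \<Rightarrow> real" where "Z = indicator A"
  define e where "e \<omega> = X n \<omega> - xs" for \<omega>
  define g where "g \<omega> = grad f (X n \<omega>)" for \<omega>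
  define a where "a \<omega> = e \<omega> - 2 *\<^sub>R (gram_outer k (\<lambda>j. eigvec n j \<omega>) *v e \<omega>)" for \<omega>
  have fm: "f \<in> borel_measurable borel"
    using f.dderiv_continuous[of "[]"]
    by (intro borel_measurable_continuous_onI) (simp add: continuous_on_cong[of UNIV UNIV "dderiv f []" f])
  have Xm[measurable]: "X n \<in> borel_measurable (\<G> n)" by (intro measurable_iterate_\<G> fm k) simp
  have Z[measurable]: "Z \<in> borel_measurable (\<G> n)" unfolding Z_def using A by measurable
  have e[measurable]: "e \<in> borel_measurable (\<G> n)" unfolding e_def by measurable
  have g[measurable]: "g \<in> borel_measurable (\<G> n)"
    unfolding g_def by (rule measurable_compose[OF Xm f.grad_measurable])
  have [measurable]: "(\<lambda>\<omega>. gram_outer k (\<lambda>j. eigvec n j \<omega>) *v e \<omega>) \<in> borel_measurable (\<G> n)"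
    by (intro measurable_gram_outer measurable_eigvec_\<G> fm k e)
  have a[measurable]: "a \<in> borel_measurable (\<G> n)" unfolding a_def by measurable
  have \<G>P: "h \<in> borel_measurable (\<G> n) \<Longrightarrow> h \<in> borel_measurable P" for h :: "'w \<Rightarrow> real"
    using measurable_from_subalg[OF sub_\<G>] .
  have AP: "A \<subseteq> space P" using A sets.sets_into_space space_\<G> by metis
  have norm_a: "norm (a \<omega>) = norm (e \<omega>)" if "\<omega> \<in> space P" for \<omega>
    unfolding a_def by (intro norm_reflection eigvec_orthonormal that)
  have norm_g: "norm (g \<omega>) \<le> M * norm (e \<omega>)" for \<omega>
    unfolding g_def e_def by (rule f.grad_bound[OF xs])
  have bnd: "norm (e \<omega>) \<le> \<rho>" "norm (a \<omega>) \<le> \<rho>" "norm (g \<omega>) \<le> M * \<rho>" "0 \<le> \<rho>" if "\<omega> \<in> A" for \<omega>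
  proof -
    show 1: "norm (e \<omega>) \<le> \<rho>" using \<rho>[OF that] by (simp add: e_def)
    then show "norm (a \<omega>) \<le> \<rho>" using norm_a that AP by auto
    show "norm (g \<omega>) \<le> M * \<rho>"
      using norm_g[of \<omega>] mult_left_mono[OF 1, of M] f.M_pos by linarith
    show "0 \<le> \<rho>" using 1 norm_ge_zero order_trans by blast
  qed
  have intZ: "integrable P (\<lambda>\<omega>. Z \<omega> * h \<omega>)"
    if "h \<in> borel_measurable (\<G> n)" "\<And>\<omega>. \<omega> \<in> A \<Longrightarrow> \<bar>h \<omega>\<bar> \<le> C" for h and C :: real
  proof (rule integrable_const_bound)
    show "AE \<omega> in P. norm (Z \<omega> * h \<omega>) \<le> \<bar>C\<bar>"
      using that(2) by (intro AE_I2) (auto simp: Z_def indicator_def order_trans[OF _ abs_ge_self])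
    show "(\<lambda>\<omega>. Z \<omega> * h \<omega>) \<in> borel_measurable P" using that(1) by (intro \<G>P) measurable
  qed
  have int_comp: "integrable P (\<lambda>\<omega>. Z \<omega> * (y \<omega> $ i * z \<omega> $ j))"
    if "y \<in> borel_measurable (\<G> n)" "z \<in> borel_measurable (\<G> n)"
      "\<And>\<omega>. \<omega> \<in> A \<Longrightarrow> norm (y \<omega>) \<le> C" "\<And>\<omega>. \<omega> \<in> A \<Longrightarrow> norm (z \<omega>) \<le> C'"
    for y z :: "'w \<Rightarrow> real^'n" and C C' i j
  proof (rule intZ)
    note [measurable] = that(1,2)
    show "(\<lambda>\<omega>. y \<omega> $ i * z \<omega> $ j) \<in> borel_measurable (\<G> n)" by measurable
    show "\<bar>y \<omega> $ i * z \<omega> $ j\<bar> \<le> C * C'" if \<omega>: "\<omega> \<in> A" for \<omega>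
      unfolding abs_mult using \<open>\<And>\<omega>. \<omega> \<in> A \<Longrightarrow> norm (y \<omega>) \<le> C\<close>[OF \<omega>] \<open>\<And>\<omega>. \<omega> \<in> A \<Longrightarrow> norm (z \<omega>) \<le> C'\<close>[OF \<omega>]
        component_le_norm_cart[of "y \<omega>" i] component_le_norm_cart[of "z \<omega>" j]
      by (intro mult_mono) (auto intro: order_trans[OF norm_ge_zero])
  qed
  have int_inner: "integrable P (\<lambda>\<omega>. Z \<omega> * (y \<omega> \<bullet> z \<omega>))"
    if "y \<in> borel_measurable (\<G> n)" "z \<in> borel_measurable (\<G> n)"
      "\<And>\<omega>. \<omega> \<in> A \<Longrightarrow> norm (y \<omega>) \<le> C" "\<And>\<omega>. \<omega> \<in> A \<Longrightarrow> norm (z \<omega>) \<le> C'"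
    for y z :: "'w \<Rightarrow> real^'n" and C C'
    unfolding inner_vec_def sum_distrib_left inner_real_def
    by (intro Bochner_Integration.integrable_sum int_comp[OF that])
  have comp_m: "(\<lambda>\<omega>. Z \<omega> * (y \<omega> $ i * z \<omega> $ j)) \<in> borel_measurable (\<G> n)"
    if [measurable]: "y \<in> borel_measurable (\<G> n)" "z \<in> borel_measurable (\<G> n)"
    for y z :: "'w \<Rightarrow> real^'n" and i j by measurable
  have int_e2: "integrable P (\<lambda>\<omega>. Z \<omega> * (norm (e \<omega>))\<^sup>2)"
    unfolding power2_norm_eq_inner by (rule int_inner[OF e e bnd(1) bnd(1)])
  have int_ag: "integrable P (\<lambda>\<omega>. Z \<omega> * (a \<omega> \<bullet> g \<omega>))" by (rule int_inner[OF a g bnd(2) bnd(3)])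
  have int_gg: "integrable P (\<lambda>\<omega>. Z \<omega> * (g \<omega> \<bullet> g \<omega>))" by (rule int_inner[OF g g bnd(3) bnd(3)])
  have int_e: "integrable P (\<lambda>\<omega>. Z \<omega> * norm (e \<omega>))" by (rule intZ[of _ \<rho>]) (use bnd(1) in auto)
  have int_Z: "integrable P Z" using intZ[of "\<lambda>_. 1" 1] by simp
  define E where "E = expectation (\<lambda>\<omega>. Z \<omega> * (norm (e \<omega>))\<^sup>2)"
  \<comment> \<open>The factor \<open>1 *\<close> plays the role of \<open>\<phi>\<close> in
    \<open>has_bochner_integral_fresh_bilinear\<close>.\<close>
  have pair: "has_bochner_integral std_gaussian (\<lambda>x::real^'n. 1 * (x $ i * x $ j)) (if i = j then 1 else 0)" for i j
    using has_bochner_integral_gaussian_pair[of i j] by simp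
  have npair: "has_bochner_integral std_gaussian (\<lambda>x::real^'n. (norm x)\<^sup>2 * (x $ i * x $ j)) (if i = j then d + 2 else 0)" for i j
    unfolding d_def by (rule has_bochner_integral_gaussian_norm_pair)
  have hb: "has_bochner_integral std_gaussian (\<lambda>x::real^'n. norm x ^ p) (integral\<^sup>L std_gaussian (\<lambda>x::real^'n. norm x ^ p))" for p
    by (simp add: has_bochner_integral_iff integrable_gaussian_norm_power)
  \<comment> \<open>The bound of \<open>norm_step_le\<close> multiplied by the indicator, with each
    term arranged to match one of the two product rules.\<close>
  let ?R = "\<lambda>\<omega>. Z \<omega> * (norm (e \<omega>))\<^sup>2 - 2 * \<alpha> * (Z \<omega> * (1 * ((a \<omega> \<bullet> r n \<omega>) * (g \<omega> \<bullet> r n \<omega>))))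
    + 2 * \<alpha> * B * (Z \<omega> * norm (e \<omega>) * norm (r n \<omega>) ^ 4)
    + 2 * \<alpha>\<^sup>2 * (Z \<omega> * ((norm (r n \<omega>))\<^sup>2 * ((g \<omega> \<bullet> r n \<omega>) * (g \<omega> \<bullet> r n \<omega>))))
    + 2 * \<alpha>\<^sup>2 * B\<^sup>2 * (Z \<omega> * norm (r n \<omega>) ^ 8)"
  have R: "has_bochner_integral P ?R (E - 2 * \<alpha> * (expectation (\<lambda>\<omega>. Z \<omega> * (a \<omega> \<bullet> g \<omega>)) * 1)
      + 2 * \<alpha> * B * (expectation (\<lambda>\<omega>. Z \<omega> * norm (e \<omega>)) * m4)
      + 2 * \<alpha>\<^sup>2 * (expectation (\<lambda>\<omega>. Z \<omega> * (g \<omega> \<bullet> g \<omega>)) * (d + 2))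
      + 2 * \<alpha>\<^sup>2 * B\<^sup>2 * (expectation Z * m8))"
    unfolding m4_def m8_def E_def
    by (intro has_bochner_integral_add has_bochner_integral_diff has_bochner_integral_mult_right
        has_bochner_integral_integrable int_e2
        has_bochner_integral_fresh_bilinear[OF k comp_m[OF a g] int_comp[OF a g bnd(2) bnd(3)] pair]
        has_bochner_integral_fresh_bilinear[OF k comp_m[OF g g] int_comp[OF g g bnd(3) bnd(3)] npair]
        has_bochner_integral_fresh_sample[OF k _ int_e hb]
        has_bochner_integral_fresh_sample[OF k Z int_Z hb]) measurable
  have le: "Z \<omega> * (norm (X (Suc n) \<omega> - xs))\<^sup>2 \<le> ?R \<omega>" for \<omega>
  proof (cases "\<omega> \<in> A")
    case True
    then have "\<omega> \<in> space P" using AP by auto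
    from norm_step_le[OF f this, of n xs] True show ?thesis
      by (simp add: Z_def e_def g_def a_def B_def)
  qed (simp add: Z_def)
  have Xm': "X (Suc n) \<in> borel_measurable P"
    using measurable_from_subalg[OF sub_\<G> measurable_iterate_\<G>[OF fm k order_refl]] .
  \<comment> \<open>The squared error is nonnegative and lies below \<open>?R\<close>, so
    \<open>?R\<close> also serves as dominating function.\<close>
  show int: "integrable P (\<lambda>\<omega>. indicator A \<omega> * (norm (X (Suc n) \<omega> - xs))\<^sup>2)"
    unfolding Z_def[symmetric]
  proof (rule Bochner_Integration.integrable_bound)
    show "integrable P ?R" using R by (rule integrable.intros)
    show "AE \<omega> in P. norm (Z \<omega> * (norm (X (Suc n) \<omega> - xs))\<^sup>2) \<le> norm (?R \<omega>)"
      by (intro AE_I2 order_trans[OF _ order_trans[OF le abs_ge_self, folded real_norm_def]]) (simp add: Z_def)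
    show "(\<lambda>\<omega>. Z \<omega> * (norm (X (Suc n) \<omega> - xs))\<^sup>2) \<in> borel_measurable P"
      using Xm' \<G>P[OF Z] by measurable
  qed
  have "expectation (\<lambda>\<omega>. Z \<omega> * (norm (X (Suc n) \<omega> - xs))\<^sup>2) \<le> expectation ?R"
    using int[folded Z_def] le R by (intro integral_mono) (auto simp: has_bochner_integral_iff)
  also have "expectation ?R = E - 2 * \<alpha> * expectation (\<lambda>\<omega>. Z \<omega> * (a \<omega> \<bullet> g \<omega>))
      + 2 * \<alpha> * B * (expectation (\<lambda>\<omega>. Z \<omega> * norm (e \<omega>)) * m4)
      + 2 * \<alpha>\<^sup>2 * (expectation (\<lambda>\<omega>. Z \<omega> * (g \<omega> \<bullet> g \<omega>)) * (d + 2))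
      + 2 * \<alpha>\<^sup>2 * B\<^sup>2 * (expectation Z * m8)"
    using has_bochner_integral_integral_eq[OF R] by simp
  also have "\<dots> \<le> E - 2 * \<alpha> * (c * E) + \<alpha> * (\<eta> * E + (B * m4)\<^sup>2 / \<eta>)
      + 2 * \<alpha>\<^sup>2 * (M\<^sup>2 * E * (d + 2)) + 2 * \<alpha>\<^sup>2 * B\<^sup>2 * (1 * m8)"
  proof -
    have ag: "c * E \<le> expectation (\<lambda>\<omega>. Z \<omega> * (a \<omega> \<bullet> g \<omega>))"
      unfolding E_def integral_mult_right_zero[symmetric]
    proof (rule integral_mono_AE)
      show "AE \<omega> in P. c * (Z \<omega> * (norm (e \<omega>))\<^sup>2) \<le> Z \<omega> * (a \<omega> \<bullet> g \<omega>)"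
        using c
      proof (rule AE_mp, intro AE_I2 impI)
        fix \<omega>
        assume *: "\<omega> \<in> A \<longrightarrow> c * (norm (X n \<omega> - xs))\<^sup>2
          \<le> (X n \<omega> - xs) \<bullet> ((mat 1 - 2 *\<^sub>R gram_outer k (\<lambda>j. eigvec n j \<omega>)) *v grad f (X n \<omega>))"
        have "e \<omega> \<bullet> ((mat 1 - 2 *\<^sub>R gram_outer k (\<lambda>j. eigvec n j \<omega>)) *v g \<omega>) = a \<omega> \<bullet> g \<omega>"
          unfolding a_def
          by (simp add: matrix_vector_mult_diff_rdistrib inner_diff_left inner_diff_right
              gram_outer_symmetric flip: scaleR_matrix_vector_assoc)
        then show "c * (Z \<omega> * (norm (e \<omega>))\<^sup>2) \<le> Z \<omega> * (a \<omega> \<bullet> g \<omega>)"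
          using * by (auto simp: Z_def indicator_def e_def g_def)
      qed
    qed (use int_e2 int_ag in auto)
    have "expectation (\<lambda>\<omega>. 2 * (B * m4) * (Z \<omega> * norm (e \<omega>)))
        \<le> expectation (\<lambda>\<omega>. \<eta> * (Z \<omega> * (norm (e \<omega>))\<^sup>2) + (B * m4)\<^sup>2 / \<eta>)"
    proof (rule integral_mono)
      fix \<omega>
      \<comment> \<open>Completing the square trades the term linear in the error, of size
        \<open>l\<^sup>2\<close>, for \<open>\<eta>\<close> times the squared error plus a term of
        size \<open>l ^ 4\<close>. Outside \<open>A\<close> only the nonnegative constant
        remains.\<close>
      have "0 \<le> (\<eta> * norm (e \<omega>) - B * m4)\<^sup>2 / \<eta>" using \<eta> by simp
      also have "\<dots> = \<eta> * (norm (e \<omega>))\<^sup>2 - 2 * (B * m4) * norm (e \<omega>) + (B * m4)\<^sup>2 / \<eta>"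
        using \<eta> by (simp add: power2_eq_square field_simps)
      finally show "2 * (B * m4) * (Z \<omega> * norm (e \<omega>)) \<le> \<eta> * (Z \<omega> * (norm (e \<omega>))\<^sup>2) + (B * m4)\<^sup>2 / \<eta>"
        using \<eta> by (auto simp: Z_def indicator_def)
    qed (use int_e int_e2 in auto)
    then have me: "2 * (B * m4) * expectation (\<lambda>\<omega>. Z \<omega> * norm (e \<omega>)) \<le> \<eta> * E + (B * m4)\<^sup>2 / \<eta>"
      using int_e2 by (simp add: E_def prob_space)
    have gg: "expectation (\<lambda>\<omega>. Z \<omega> * (g \<omega> \<bullet> g \<omega>)) \<le> M\<^sup>2 * E"
      unfolding E_def integral_mult_right_zero[symmetric]
    proof (rule integral_mono)
      fix \<omega>
      have "g \<omega> \<bullet> g \<omega> \<le> M\<^sup>2 * (norm (e \<omega>))\<^sup>2"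
        using power_mono[OF norm_g[of \<omega>], of 2] by (simp add: power2_norm_eq_inner power_mult_distrib)
      then show "Z \<omega> * (g \<omega> \<bullet> g \<omega>) \<le> M\<^sup>2 * (Z \<omega> * (norm (e \<omega>))\<^sup>2)"
        by (auto simp: Z_def indicator_def)
    qed (use int_gg int_e2 in auto)
    have Z1: "expectation Z \<le> 1"
      by (rule integral_le_const[OF int_Z]) (auto simp: Z_def indicator_def)
    have m8: "0 \<le> m8" unfolding m8_def by (intro integral_nonneg_AE) auto
    have "2 * \<alpha> * (c * E) \<le> 2 * \<alpha> * expectation (\<lambda>\<omega>. Z \<omega> * (a \<omega> \<bullet> g \<omega>))"
      using \<alpha>_pos by (intro mult_left_mono ag) simp
    moreover have "2 * \<alpha> * B * (expectation (\<lambda>\<omega>. Z \<omega> * norm (e \<omega>)) * m4)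
        = \<alpha> * (2 * (B * m4) * expectation (\<lambda>\<omega>. Z \<omega> * norm (e \<omega>)))" by simp
    moreover have "\<dots> \<le> \<alpha> * (\<eta> * E + (B * m4)\<^sup>2 / \<eta>)"
      using \<alpha>_pos by (intro mult_left_mono me) simp
    moreover have "2 * \<alpha>\<^sup>2 * (expectation (\<lambda>\<omega>. Z \<omega> * (g \<omega> \<bullet> g \<omega>)) * (d + 2)) \<le> 2 * \<alpha>\<^sup>2 * (M\<^sup>2 * E * (d + 2))"
      by (intro mult_left_mono mult_right_mono gg) (auto simp: d_def)
    moreover have "2 * \<alpha>\<^sup>2 * B\<^sup>2 * (expectation Z * m8) \<le> 2 * \<alpha>\<^sup>2 * B\<^sup>2 * (1 * m8)"
      using m8 by (intro mult_left_mono mult_right_mono Z1) auto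
    ultimately show ?thesis by linarith
  qed
  also have "\<dots> = (1 - 2 * \<alpha> * c + \<alpha> * \<eta> + \<alpha>\<^sup>2 * ((2 * d + 4) * M\<^sup>2)) * E
      + (\<alpha> * ((M / 6 * m4)\<^sup>2 / \<eta>) + 2 * \<alpha>\<^sup>2 * ((M / 6)\<^sup>2 * m8)) * l ^ 4"
  proof -
    have B2: "B\<^sup>2 = (M / 6)\<^sup>2 * l ^ 4" by (simp add: B_def power2_eq_square power4_eq_xxxx)
    then have "(B * m4)\<^sup>2 = (M / 6 * m4)\<^sup>2 * l ^ 4" by (simp add: power_mult_distrib power_divide)
    then show ?thesis unfolding B2 by (simp add: algebra_simps)
  qed
  finally show "expectation (\<lambda>\<omega>. indicator A \<omega> * (norm (X (Suc n) \<omega> - xs))\<^sup>2)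
      \<le> (1 - 2 * \<alpha> * c + \<alpha> * \<eta> + \<alpha>\<^sup>2 * ((2 * real CARD('n) + 4) * M\<^sup>2))
          * expectation (\<lambda>\<omega>. indicator A \<omega> * (norm (X n \<omega> - xs))\<^sup>2)
        + (\<alpha> * ((M / 6 * m4)\<^sup>2 / \<eta>) + 2 * \<alpha>\<^sup>2 * ((M / 6)\<^sup>2 * m8)) * l ^ 4"
    unfolding E_def d_def e_def Z_def .
qed

end

section \<open>Constants and the conditional mean square bound\<close>

text \<open>The lower bound imposed on \<open>\<theta>\<close> limits the squared difference length
  by a multiple of \<open>\<theta>\<close>, so the smoothing error in the Hessian is of order
  \<open>\<surd>\<theta>\<close>. The factor \<open>3 * M + \<mu>\<close> is the slack that
  \<open>c\<close> leaves for it in \<open>reflected_gradient_ge_trust_region\<close>.\<close>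

lemma gap_bounds:
  fixes \<theta> \<mu> M l :: real and d k :: nat
  assumes acc: "accuracy_parameters d k M \<mu> l \<theta>" and k: "1 \<le> k" and \<mu>: "0 < \<mu>" "\<mu> < M" and l: "0 < l"
  shows "0 < \<theta>" and "2 * (M * l * sqrt (real d)) \<le> (3 * M + \<mu>) * sqrt \<theta>"
proof -
  let ?q = "M * l\<^sup>2 * real d"
  have M: "0 < M" using \<mu> by simp
  have \<theta>: "sqrt (2 * real k) * ?q / (4 * \<mu>) < \<theta>" "0 < sqrt (2 * real k) * ?q / (4 * \<mu>)"
    using acc by (auto simp: accuracy_parameters_def Let_def mult.assoc)
  then show pos: "0 < \<theta>" by linarith
  \<comment> \<open>The value \<open>4 / 3\<close> lies below the root of 2 and gives the round
    bound \<open>3 * \<mu> * \<theta>\<close> for \<open>?q\<close>.\<close>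
  have "4 / 3 \<le> sqrt (2 * real k)" using k by (intro real_le_rsqrt) (simp add: power2_eq_square)
  moreover have "0 \<le> ?q" using M by simp
  ultimately have "4 / 3 * ?q \<le> sqrt (2 * real k) * ?q" by (rule mult_right_mono)
  also have "\<dots> < \<theta> * (4 * \<mu>)" using \<theta>(1) \<mu> by (simp add: pos_divide_less_eq)
  finally have "?q \<le> 3 * \<mu> * \<theta>" by (simp add: mult_ac)
  then have "4 * M * ?q \<le> 4 * M * (3 * \<mu> * \<theta>)" using M by (intro mult_left_mono) auto
  \<comment> \<open>Inequality of arithmetic and geometric means for \<open>3 * M\<close> and
    \<open>\<mu>\<close>, which makes both sides squares.\<close>
  also have "\<dots> \<le> (3 * M + \<mu>)\<^sup>2 * \<theta>"
  proof -
    have "0 \<le> (3 * M - \<mu>)\<^sup>2 * \<theta>" using pos by simp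
    then show ?thesis by (simp add: power2_eq_square algebra_simps)
  qed
  finally have "(2 * (M * l * sqrt (real d)))\<^sup>2 \<le> ((3 * M + \<mu>) * sqrt \<theta>)\<^sup>2"
    using pos by (simp add: power_mult_distrib power2_eq_square[of M] mult_ac)
  then show "2 * (M * l * sqrt (real d)) \<le> (3 * M + \<mu>) * sqrt \<theta>"
    by (rule power2_le_imp_le) (use M \<mu> pos in simp)
qed

text \<open>\<open>b\<close> is the fixed point of the affine map, so only the distance to it is
  contracted.\<close>

lemma affine_recursion_bound:
  fixes u :: "nat \<Rightarrow> real"
  assumes "0 \<le> s" "\<And>n. u (Suc n) \<le> s * u n + (1 - s) * b" "0 \<le> b"
  shows "u n \<le> s ^ n * u 0 + b"
proof (induction n)
  case (Suc n)
  have "u (Suc n) \<le> s * (s ^ n * u 0 + b) + (1 - s) * b"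
    using assms(2)[of n] mult_left_mono[OF Suc.IH assms(1)] by linarith
  then show ?case by (simp add: algebra_simps)
qed (use assms in simp)

lemma trust_region_radius:
  assumes "x \<in> trust_region xs M \<mu> \<delta> \<theta>" "0 < M"
  shows "norm (x - xs) \<le> \<delta>" "M * norm (x - xs) \<le> (1 - sqrt \<theta>) * \<mu> - M * \<theta> - 5 * M * sqrt \<theta>"
proof -
  have "norm (x - xs) \<le> (1 - sqrt \<theta>) * \<mu> / M - \<theta> - 5 * sqrt \<theta>" and "norm (x - xs) \<le> \<delta>"
    using assms by (auto simp: trust_region_def)
  from mult_left_mono[OF this(1), of M] this(2) assms(2)
  show "norm (x - xs) \<le> \<delta>" "M * norm (x - xs) \<le> (1 - sqrt \<theta>) * \<mu> - M * \<theta> - 5 * M * sqrt \<theta>"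
    by (auto simp: right_diff_distrib)
qed

lemma (in saddle_search_run) reflected_gradient_ge_trust_region:
  assumes f: "bounded_third_order f M" and k: "k \<in> {1..<CARD('n)}"
    and ev: "eigenvalue_assumption f k xs M \<mu> \<delta>"
    and par: "accuracy_parameters CARD('n) k M \<mu> l \<theta>"
    and acc: "eigenvector_accuracy P f k l \<theta> X (\<lambda>n \<omega>. gram_outer k (\<lambda>j. eigvec n j \<omega>))"
  shows "AE \<omega> in P. X n \<omega> \<in> trust_region xs M \<mu> \<delta> \<theta> \<longrightarrow>
    ((1 - sqrt \<theta>) * \<mu> - M * \<theta> - 5 * M * sqrt \<theta>) / 2 * (norm (X n \<omega> - xs))\<^sup>2
      \<le> (X n \<omega> - xs) \<bullet> ((mat 1 - 2 *\<^sub>R gram_outer k (\<lambda>j. eigvec n j \<omega>)) *v grad f (X n \<omega>))"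
proof -
  interpret f: bounded_third_order f M by fact
  define c where "c = (1 - sqrt \<theta>) * \<mu> - M * \<theta> - 5 * M * sqrt \<theta>"
  have ev': "grad f xs = 0" "0 < \<mu>" "\<mu> < M"
    "\<And>x. norm (x - xs) \<le> \<delta> \<Longrightarrow> \<exists>lam. sorted_eigenvalues (hess f x) lam \<and> lam k < - \<mu> \<and> \<mu> < lam (k + 1)"
    using ev unfolding eigenvalue_assumption_def by blast+
  let ?b = "M * l * sqrt (real CARD('n))"
  have \<theta>: "0 < \<theta>" "2 * ?b \<le> (3 * M + \<mu>) * sqrt \<theta>"
    using gap_bounds[OF par _ ev'(2,3) l_pos] k by auto
  have "AE \<omega> in P. \<exists>Q Ql.
      lowest_eigenprojection k (hess f (X n \<omega>)) Q \<and>
      lowest_eigenprojection k (hess (smoothed f l) (X n \<omega>)) Ql \<and>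
      min ((onorm (\<lambda>y. (gram_outer k (\<lambda>j. eigvec n j \<omega>) - Q) *v y))\<^sup>2)
        ((onorm (\<lambda>y. (gram_outer k (\<lambda>j. eigvec n j \<omega>) - Ql) *v y))\<^sup>2) \<le> \<theta>"
    using acc unfolding eigenvector_accuracy_def by blast
  then show ?thesis
    unfolding c_def[symmetric]
  proof (rule AE_mp, intro AE_I2 impI)
    fix \<omega>
    let ?V = "gram_outer k (\<lambda>j. eigvec n j \<omega>)" and ?x = "X n \<omega>"
    assume "\<exists>Q Ql. lowest_eigenprojection k (hess f ?x) Q \<and>
      lowest_eigenprojection k (hess (smoothed f l) ?x) Ql \<and>
      min ((onorm (\<lambda>y. (?V - Q) *v y))\<^sup>2) ((onorm (\<lambda>y. (?V - Ql) *v y))\<^sup>2) \<le> \<theta>"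
    then obtain Q Ql where Q: "lowest_eigenprojection k (hess f ?x) Q"
      "lowest_eigenprojection k (hess (smoothed f l) ?x) Ql"
      "min ((onorm (\<lambda>y. (?V - Q) *v y))\<^sup>2) ((onorm (\<lambda>y. (?V - Ql) *v y))\<^sup>2) \<le> \<theta>" by blast
    assume "?x \<in> trust_region xs M \<mu> \<delta> \<theta>"
    note radius = trust_region_radius[OF this f.M_pos]
    obtain lam where lam: "sorted_eigenvalues (hess f ?x) lam" "lam k \<le> - \<mu>" "\<mu> \<le> lam (k + 1)"
      using ev'(4)[OF radius(1)] less_imp_le by blast
    have b0: "0 \<le> ?b" using f.M_pos l_pos by simp
    have main: "(\<mu> - 2 * ?b - M * norm (?x - xs) / 2 - 2 * M * sqrt \<theta>) * (norm (?x - xs))\<^sup>2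
        \<le> (?x - xs) \<bullet> ((mat 1 - 2 *\<^sub>R ?V) *v grad f ?x)"
      by (rule f.reflected_gradient_ge[OF ev'(1) k lam Q b0 f.hess_smoothed_close[OF l_pos]])
    have "0 \<le> M * \<theta>" using f.M_pos \<theta>(1) by simp
    moreover have "(3 * M + \<mu>) * sqrt \<theta> = 3 * (M * sqrt \<theta>) + \<mu> * sqrt \<theta>" by (simp add: algebra_simps)
    moreover have "c = \<mu> - \<mu> * sqrt \<theta> - M * \<theta> - 5 * (M * sqrt \<theta>)" by (simp add: c_def algebra_simps)
    \<comment> \<open>In the trust region \<open>M * norm (?x - xs) \<le> c\<close>, so the Taylor
      error takes at most \<open>c / 2\<close>. What remains to be checked is
      \<open>2 * ?b \<le> (3 * M + \<mu>) * sqrt \<theta> + M * \<theta>\<close>.\<close>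
    ultimately have "c / 2 \<le> \<mu> - 2 * ?b - M * norm (?x - xs) / 2 - 2 * M * sqrt \<theta>"
      using \<theta>(2) radius(2)[folded c_def] by simp
    from mult_right_mono[OF this, of "(norm (?x - xs))\<^sup>2"] main
    show "c / 2 * (norm (?x - xs))\<^sup>2 \<le> (?x - xs) \<bullet> ((mat 1 - 2 *\<^sub>R ?V) *v grad f ?x)"
      by (meson order_trans zero_le_power2)
  qed
qed

text \<open>The constant \<open>\<kappa>\<close> is half of the upper bound on
  \<open>\<alpha>\<close>. With it the quadratic term of the step uses up the contraction
  \<open>\<alpha> * c\<close> except for \<open>2 * \<alpha> * \<kappa>\<close>: one half pays for
  the discretisation error, the other is the net decay.\<close>

lemma (in saddle_search_run) cond_mean_square_bound:
  assumes f: "bounded_third_order f M" and k: "k \<in> {1..<CARD('n)}"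
    and ev: "eigenvalue_assumption f k xs M \<mu> \<delta>"
    and par: "accuracy_parameters CARD('n) k M \<mu> l \<theta>"
    and acc: "eigenvector_accuracy P f k l \<theta> X (\<lambda>n \<omega>. gram_outer k (\<lambda>j. eigvec n j \<omega>))"
    and pos: "0 < prob (stays_in P X (trust_region xs M \<mu> \<delta> \<theta>))"
  defines "c \<equiv> (1 - sqrt \<theta>) * \<mu> - M * \<theta> - 5 * M * sqrt \<theta>"
    and "K \<equiv> (2 * real CARD('n) + 4) * M\<^sup>2"
    and "m4 \<equiv> integral\<^sup>L std_gaussian (\<lambda>x::real^'n. norm x ^ 4)"
    and "m8 \<equiv> integral\<^sup>L std_gaussian (\<lambda>x::real^'n. norm x ^ 8)"
  assumes \<alpha>: "\<alpha> < c / (K + 1)"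
  defines "\<kappa> \<equiv> c / (2 * (K + 1))"
  defines "D \<equiv> (M / 6 * m4)\<^sup>2 / \<kappa> + 4 * \<kappa> * ((M / 6)\<^sup>2 * m8)"
  assumes \<sigma>: "0 \<le> 1 - \<alpha> * \<kappa>"
  shows "cond_expectation P (stays_in P X (trust_region xs M \<mu> \<delta> \<theta>)) (\<lambda>\<omega>. (norm (X n \<omega> - xs))\<^sup>2)
    \<le> (\<delta>\<^sup>2 + 2 * D) / prob (stays_in P X (trust_region xs M \<mu> \<delta> \<theta>)) * ((1 - \<alpha> * \<kappa>) ^ n + l ^ 4 / \<alpha>)"
proof -
  interpret f: bounded_third_order f M by fact
  let ?U = "trust_region xs M \<mu> \<delta> \<theta>"
  define E where "E = stays_in P X ?U"
  \<comment> \<open>\<open>E\<close> depends on the whole future of the run; \<open>A n\<close> only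
    looks at iterates up to time \<open>n\<close> and therefore belongs to
    \<open>\<G> n\<close>.\<close>
  define A where "A n = {\<omega> \<in> space P. \<forall>m\<le>n. X m \<omega> \<in> ?U}" for n
  define u where "u n = expectation (\<lambda>\<omega>. indicator (A n) \<omega> * (norm (X n \<omega> - xs))\<^sup>2)" for n
  have k1: "1 \<le> k" using k by simp
  have K: "0 \<le> K" by (simp add: K_def)
  have "0 < c / (K + 1)" using \<alpha> \<alpha>_pos by linarith
  then have c: "0 < c" using K by (simp add: zero_less_divide_iff)
  have \<kappa>: "0 < \<kappa>" and \<kappa>2: "2 * \<kappa> = c / (K + 1)" using c K by (auto simp: \<kappa>_def simp del: distrib_left_numeral)
  have m8: "0 \<le> m8" unfolding m8_def by (intro integral_nonneg_AE) auto
  have D: "0 \<le> D" using \<kappa> m8 by (simp add: D_def)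
  have xs: "grad f xs = 0" and \<delta>: "0 < \<delta>" using ev by (auto simp: eigenvalue_assumption_def)
  have fm: "f \<in> borel_measurable borel" using f.dderiv_measurable[of "[]"] by (simp add: measurable_cong[of _ "dderiv f []" f])
  have U: "?U \<in> sets borel"
  proof -
    have "?U = cball xs (min ((1 - sqrt \<theta>) * \<mu> / M - \<theta> - 5 * sqrt \<theta>) \<delta>)"
      by (auto simp: trust_region_def dist_norm norm_minus_commute)
    then show ?thesis by simp
  qed
  have A\<G>: "A n \<in> sets (\<G> n)" for n
  proof -
    have "X m -` ?U \<inter> space (\<G> n) \<in> sets (\<G> n)" if "m \<le> n" for m
      by (rule measurable_sets[OF measurable_iterate_\<G>[OF fm k1 that] U])
    then have "(\<Inter>m\<in>{..n}. X m -` ?U \<inter> space (\<G> n)) \<in> sets (\<G> n)" by (intro sets.finite_INT) auto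
    also have "(\<Inter>m\<in>{..n}. X m -` ?U \<inter> space (\<G> n)) = A n" by (auto simp: A_def space_\<G>)
    finally show ?thesis .
  qed
  have A\<delta>: "norm (X n \<omega> - xs) \<le> \<delta>" if "\<omega> \<in> A n" for n \<omega>
    using that trust_region_radius(1)[OF _ f.M_pos] unfolding A_def by blast
  have contraction: "AE \<omega> in P. \<omega> \<in> A n \<longrightarrow> c / 2 * (norm (X n \<omega> - xs))\<^sup>2
      \<le> (X n \<omega> - xs) \<bullet> ((mat 1 - 2 *\<^sub>R gram_outer k (\<lambda>j. eigvec n j \<omega>)) *v grad f (X n \<omega>))" for n
    using reflected_gradient_ge_trust_region[OF f k ev par acc, of n]
    by (rule AE_mp) (auto simp: A_def c_def)
  \<comment> \<open>Contraction constant \<open>c / 2\<close>, and \<open>\<eta>\<close> taken to be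
    \<open>\<kappa>\<close>.\<close>
  note step = mean_square_step[OF f k1 xs A\<G> A\<delta> contraction \<kappa>, folded m4_def m8_def K_def]
  have int: "integrable P (\<lambda>\<omega>. indicator (A n) \<omega> * (norm (X n \<omega> - xs))\<^sup>2)" for n
  proof (rule integrable_const_bound)
    show "AE \<omega> in P. norm (indicator (A n) \<omega> * (norm (X n \<omega> - xs))\<^sup>2) \<le> \<delta>\<^sup>2"
      using A\<delta> by (intro AE_I2) (auto simp: indicator_def intro!: power_mono)
    have [measurable]: "A n \<in> events" "X n \<in> borel_measurable P"
      using A\<G> sub_\<G>[of n] measurable_from_subalg[OF sub_\<G> measurable_iterate_\<G>[OF fm k1 order_refl]]
      by (auto simp: subalgebra_def)
    show "(\<lambda>\<omega>. indicator (A n) \<omega> * (norm (X n \<omega> - xs))\<^sup>2) \<in> borel_measurable P" by measurable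
  qed
  have u0: "u 0 \<le> \<delta>\<^sup>2"
    unfolding u_def using A\<delta> by (intro integral_le_const[OF int]) (auto simp: indicator_def intro!: power_mono)
  have unn: "0 \<le> u n" for n unfolding u_def by (intro integral_nonneg_AE) auto
  have usub: "u (Suc n) \<le> (1 - \<alpha> * \<kappa>) * u n + (1 - (1 - \<alpha> * \<kappa>)) * (D * l ^ 4 / \<kappa>)" for n
  proof -
    \<comment> \<open>\<open>A (Suc n)\<close> is contained in \<open>A n\<close> and the integrand
      is nonnegative.\<close>
    have "u (Suc n) \<le> expectation (\<lambda>\<omega>. indicator (A n) \<omega> * (norm (X (Suc n) \<omega> - xs))\<^sup>2)"
      unfolding u_def
      by (intro integral_mono int step(1)) (auto simp: A_def indicator_def)
    also have "\<dots> \<le> (1 - 2 * \<alpha> * (c / 2) + \<alpha> * \<kappa> + \<alpha>\<^sup>2 * K) * u n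
        + (\<alpha> * ((M / 6 * m4)\<^sup>2 / \<kappa>) + 2 * \<alpha>\<^sup>2 * ((M / 6)\<^sup>2 * m8)) * l ^ 4"
      unfolding u_def by (rule step(2))
    also have "\<dots> \<le> (1 - \<alpha> * \<kappa>) * u n + (\<alpha> * D) * l ^ 4"
    proof (intro add_mono mult_right_mono unn)
      have "\<alpha> * K \<le> 2 * \<kappa> * K" using \<alpha> \<kappa>2 K by (intro mult_right_mono) auto
      \<comment> \<open>Since \<open>2 * \<kappa> * (K + 1) = c\<close>; the summand 1 in the
        denominator of the step size bound is what leaves \<open>2 * \<kappa>\<close> over.\<close>
      also have "\<dots> = c - 2 * \<kappa>" using K by (simp add: \<kappa>_def field_simps)
      finally have "\<alpha> * (\<alpha> * K) \<le> \<alpha> * (c - 2 * \<kappa>)" using \<alpha>_pos by (intro mult_left_mono) auto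
      then show "1 - 2 * \<alpha> * (c / 2) + \<alpha> * \<kappa> + \<alpha>\<^sup>2 * K \<le> 1 - \<alpha> * \<kappa>"
        by (simp add: power2_eq_square algebra_simps)
      \<comment> \<open>One of the two factors \<open>\<alpha>\<close> is replaced by its bound
        \<open>2 * \<kappa>\<close>, so that \<open>D\<close> does not involve
        \<open>\<alpha>\<close>.\<close>
      have "\<alpha> * (2 * \<alpha> * ((M / 6)\<^sup>2 * m8)) \<le> \<alpha> * (2 * (2 * \<kappa>) * ((M / 6)\<^sup>2 * m8))"
        using \<alpha> \<kappa>2 \<alpha>_pos m8 by (intro mult_left_mono mult_right_mono) auto
      then show "\<alpha> * ((M / 6 * m4)\<^sup>2 / \<kappa>) + 2 * \<alpha>\<^sup>2 * ((M / 6)\<^sup>2 * m8) \<le> \<alpha> * D"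
        unfolding D_def distrib_left by (simp add: power2_eq_square mult_ac)
    qed simp
    also have "(\<alpha> * D) * l ^ 4 = (1 - (1 - \<alpha> * \<kappa>)) * (D * l ^ 4 / \<kappa>)" using \<kappa> by simp
    finally show ?thesis .
  qed
  have "u n \<le> (1 - \<alpha> * \<kappa>) ^ n * u 0 + D * l ^ 4 / \<kappa>"
    by (rule affine_recursion_bound[where u = u, OF \<sigma> usub]) (use D \<kappa> l_pos in simp)
  also have "\<dots> \<le> (1 - \<alpha> * \<kappa>) ^ n * (\<delta>\<^sup>2 + 2 * D) + (\<delta>\<^sup>2 + 2 * D) * (l ^ 4 / \<alpha>)"
  proof (intro add_mono mult_left_mono)
    show "u 0 \<le> \<delta>\<^sup>2 + 2 * D" using u0 D by simp
    \<comment> \<open>The limit of the recursion carries \<open>1 / \<kappa>\<close>; as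
      \<open>\<alpha> < 2 * \<kappa>\<close>, this is at most \<open>2 / \<alpha>\<close>, which is
      the form \<open>l ^ 4 / \<alpha>\<close> of the claim.\<close>
    have "D * l ^ 4 / \<kappa> = D * l ^ 4 * (1 / \<kappa>)" by simp
    also have "\<dots> \<le> D * l ^ 4 * (2 / \<alpha>)"
      using \<alpha> \<kappa>2 \<kappa> \<alpha>_pos D l_pos by (intro mult_left_mono) (auto simp: field_simps)
    also have "\<dots> = 2 * D * (l ^ 4 / \<alpha>)" by simp
    also have "\<dots> \<le> (\<delta>\<^sup>2 + 2 * D) * (l ^ 4 / \<alpha>)" using \<alpha>_pos l_pos by (intro mult_right_mono) auto
    finally show "D * l ^ 4 / \<kappa> \<le> (\<delta>\<^sup>2 + 2 * D) * (l ^ 4 / \<alpha>)" .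
  qed (use \<sigma> in simp)
  also have "\<dots> = (\<delta>\<^sup>2 + 2 * D) * ((1 - \<alpha> * \<kappa>) ^ n + l ^ 4 / \<alpha>)" by (simp add: distrib_left mult.commute)
  finally have u: "u n \<le> (\<delta>\<^sup>2 + 2 * D) * ((1 - \<alpha> * \<kappa>) ^ n + l ^ 4 / \<alpha>)" .
  \<comment> \<open>\<open>E\<close> is contained in every \<open>A n\<close>, so conditioning on
    \<open>E\<close> costs only the division by its probability.\<close>
  have "(LINT \<omega>:E|P. (norm (X n \<omega> - xs))\<^sup>2) \<le> u n"
    unfolding u_def set_lebesgue_integral_def
    by (rule integral_mono'[OF int]) (auto simp: E_def A_def stays_in_def indicator_def)
  with u have "(LINT \<omega>:E|P. (norm (X n \<omega> - xs))\<^sup>2) \<le> (\<delta>\<^sup>2 + 2 * D) * ((1 - \<alpha> * \<kappa>) ^ n + l ^ 4 / \<alpha>)"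
    by linarith
  from divide_right_mono[OF this, of "prob E"] show ?thesis
    unfolding cond_expectation_def E_def using pos by simp
qed

text \<open>The order of the quantifiers makes the constants uniform: \<open>C\<close> is chosen
  before the step size, the difference length and the run, and sees the run only through the
  probability of the boundedness event; \<open>\<sigma>\<close> may depend on
  \<open>\<alpha>\<close> but not on \<open>l\<close> or the run.\<close>

theorem theorem4p14:
  fixes f :: "real^'n \<Rightarrow> real" and xs :: "real^'n" and k :: nat and M \<mu> \<delta> \<theta> :: real
  assumes "2 \<le> CARD('n)" and "1 \<le> k" and "k \<le> CARD('n) - 1"
    and "C_k 6 f" and "0 < M"
    and "\<And>i y. i \<in> {2..6} \<Longrightarrow> deriv_norm i f y \<le> ereal M"
    and "eigenvalue_assumption f k xs M \<mu> \<delta>"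
  shows "\<exists>C :: real \<Rightarrow> real. \<forall>\<alpha>.
    0 < \<alpha> \<and>
    \<alpha> < ((1 - sqrt \<theta>) * \<mu> - M * \<theta> - 5 * M * sqrt \<theta>) / ((2 * real CARD('n) + 4) * M\<^sup>2 + 1) \<longrightarrow>
    (\<exists>\<sigma>. 0 < \<sigma> \<and> \<sigma> < 1 \<and>
      (\<forall>l (P :: 'w measure) \<alpha>v lv X r v s N \<F> \<G>.
         0 < l \<and>
         accuracy_parameters CARD('n) k M \<mu> l \<theta> \<and>
         saddle_search_run P f k l \<alpha> \<alpha>v lv X r v s N \<F> \<G> \<and>
         eigenvector_accuracy P f k l \<theta> X (\<lambda>n \<omega>. gram_outer k (\<lambda>j. v n j (N n j \<omega>) \<omega>)) \<and>
         0 < measure P (stays_in P X (trust_region xs M \<mu> \<delta> \<theta>)) \<longrightarrow>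
         (\<forall>n. cond_expectation P (stays_in P X (trust_region xs M \<mu> \<delta> \<theta>))
                (\<lambda>\<omega>. (norm (X n \<omega> - xs))\<^sup>2)
              \<le> C (measure P (stays_in P X (trust_region xs M \<mu> \<delta> \<theta>))) * (\<sigma> ^ n + l ^ 4 / \<alpha>))))"
proof -
  define c where "c = (1 - sqrt \<theta>) * \<mu> - M * \<theta> - 5 * M * sqrt \<theta>"
  define K where "K = (2 * real CARD('n) + 4) * M\<^sup>2"
  define m4 where "m4 = integral\<^sup>L std_gaussian (\<lambda>x::real^'n. norm x ^ 4)"
  define m8 where "m8 = integral\<^sup>L std_gaussian (\<lambda>x::real^'n. norm x ^ 8)"
  define \<kappa> where "\<kappa> = c / (2 * (K + 1))"
  define D where "D = (M / 6 * m4)\<^sup>2 / \<kappa> + 4 * \<kappa> * ((M / 6)\<^sup>2 * m8)"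
  have f: "bounded_third_order f M"
    using assms(4-6) by unfold_locales (auto simp: C_k_def)
  have \<mu>: "0 < \<mu>" "\<mu> < M" using assms(7) by (auto simp: eigenvalue_assumption_def)
  have k: "k \<in> {1..<CARD('n)}" using assms(1-3) by auto
  show ?thesis
  proof (intro exI[of _ "\<lambda>p. (\<delta>\<^sup>2 + 2 * D) / p"] allI impI, elim conjE)
    fix \<alpha> :: real
    assume \<alpha>: "0 < \<alpha>" "\<alpha> < ((1 - sqrt \<theta>) * \<mu> - M * \<theta> - 5 * M * sqrt \<theta>) / ((2 * real CARD('n) + 4) * M\<^sup>2 + 1)"
    show "\<exists>\<sigma>. 0 < \<sigma> \<and> \<sigma> < 1 \<and>
      (\<forall>l (P :: 'w measure) \<alpha>v lv X r v s N \<F> \<G>.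
         0 < l \<and>
         accuracy_parameters CARD('n) k M \<mu> l \<theta> \<and>
         saddle_search_run P f k l \<alpha> \<alpha>v lv X r v s N \<F> \<G> \<and>
         eigenvector_accuracy P f k l \<theta> X (\<lambda>n \<omega>. gram_outer k (\<lambda>j. v n j (N n j \<omega>) \<omega>)) \<and>
         0 < measure P (stays_in P X (trust_region xs M \<mu> \<delta> \<theta>)) \<longrightarrow>
         (\<forall>n. cond_expectation P (stays_in P X (trust_region xs M \<mu> \<delta> \<theta>))
                (\<lambda>\<omega>. (norm (X n \<omega> - xs))\<^sup>2)
              \<le> (\<delta>\<^sup>2 + 2 * D) / measure P (stays_in P X (trust_region xs M \<mu> \<delta> \<theta>)) * (\<sigma> ^ n + l ^ 4 / \<alpha>)))"
    \<comment> \<open>\<open>\<sigma>\<close> has to be chosen before the accuracy parameters are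
      known to hold. For nonpositive \<open>\<theta>\<close> they fail for every \<open>l\<close>,
      and any rate will do.\<close>
    proof (cases "0 < \<theta>")
      case False
      then have "\<not> accuracy_parameters CARD('n) k M \<mu> l \<theta>" if "0 < l" for l
        using gap_bounds(1)[OF _ assms(2) \<mu> that] by blast
      then show ?thesis by (intro exI[of _ "1 / 2"]) auto
    next
      case True
      have K: "0 \<le> K" by (simp add: K_def)
      have \<alpha>': "\<alpha> < c / (K + 1)" using \<alpha>(2) by (simp add: c_def K_def)
      then have "0 < c / (K + 1)" using \<alpha>(1) by linarith
      then have c: "0 < c" using K by (simp add: zero_less_divide_iff)
      have \<kappa>: "0 < \<kappa>" using c K by (simp add: \<kappa>_def)
      \<comment> \<open>Positivity of the rate \<open>1 - \<alpha> * \<kappa>\<close>: from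
        \<open>c \<le> \<mu> < M\<close> and \<open>M\<^sup>2 \<le> K\<close> the square of
        \<open>c\<close> is below \<open>2 * (K + 1)\<close>, while
        \<open>\<alpha> * \<kappa>\<close> is at most that square divided by
        \<open>2 * (K + 1)\<close>.\<close>
      have "\<alpha> * \<kappa> < 1"
      proof -
        have "c \<le> \<mu>" using True \<mu> by (simp add: c_def algebra_simps)
        then have "c < M" using \<mu> by simp
        have "c\<^sup>2 < 2 * (K + 1)"
        proof -
          have "c\<^sup>2 \<le> M\<^sup>2" using c \<open>c < M\<close> by (intro power_mono) auto
          also have "1 * M\<^sup>2 \<le> K" unfolding K_def by (intro mult_right_mono) auto
          finally show ?thesis using K by simp
        qed
        moreover have "\<alpha> * \<kappa> \<le> c / (K + 1) * \<kappa>" using \<alpha>' \<kappa> by (intro mult_right_mono) auto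
        moreover have "c / (K + 1) * \<kappa> = c\<^sup>2 / (2 * (K + 1) * (K + 1))"
          by (simp add: \<kappa>_def power2_eq_square mult_ac)
        moreover have "c\<^sup>2 / (2 * (K + 1) * (K + 1)) \<le> c\<^sup>2 / (2 * (K + 1) * 1)"
          using K by (intro divide_left_mono mult_left_mono mult_pos_pos) auto
        moreover have "c\<^sup>2 / (2 * (K + 1) * 1) < 1" using K \<open>c\<^sup>2 < 2 * (K + 1)\<close> by simp
        ultimately show ?thesis by linarith
      qed
      moreover have "0 < \<alpha> * \<kappa>" using \<alpha>(1) \<kappa> by simp
      moreover have "cond_expectation P (stays_in P X (trust_region xs M \<mu> \<delta> \<theta>)) (\<lambda>\<omega>. (norm (X n \<omega> - xs))\<^sup>2)
          \<le> (\<delta>\<^sup>2 + 2 * D) / measure P (stays_in P X (trust_region xs M \<mu> \<delta> \<theta>)) * ((1 - \<alpha> * \<kappa>) ^ n + l ^ 4 / \<alpha>)"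
        if "accuracy_parameters CARD('n) k M \<mu> l \<theta>" "saddle_search_run P f k l \<alpha> \<alpha>v lv X r v s N \<F> \<G>"
          "eigenvector_accuracy P f k l \<theta> X (\<lambda>n \<omega>. gram_outer k (\<lambda>j. v n j (N n j \<omega>) \<omega>))"
          "0 < measure P (stays_in P X (trust_region xs M \<mu> \<delta> \<theta>))"
        for l and P :: "'w measure" and \<alpha>v lv X r v s N \<F> \<G> n
        using saddle_search_run.cond_mean_square_bound[OF that(2) f k assms(7) that(1,3,4), folded c_def K_def m4_def m8_def]
          \<alpha>' \<open>\<alpha> * \<kappa> < 1\<close> unfolding \<kappa>_def[symmetric] D_def[symmetric] by simp
      ultimately show ?thesis by (intro exI[of _ "1 - \<alpha> * \<kappa>"]) auto
    qed
  qed
qed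

end
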